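(* (Prime Number Theorem) Let $\pi(x)$ denote the number of primes $p \le x$. Then $\pi(x) \sim \frac{x}{\log x}$ as $x \to \infty$; in other words, $$\lim_{x\to\infty} \frac{\pi(x)\log x}{x} = 1.$$
   Context: For each real $x \ge 0$, $\pi(x)$ is the number of primes $\le x$. $\log$ is the natural logarithm. For functions $f,g$ of a real variable, $g(x)\sim f(x)$ means $\lim_{x\to\infty} f(x)/g(x) = 1$. *)

theory Defs
  imports Complex_Main "HOL-Computational_Algebra.Primes" "HOL-Library.Landau_Symbols"
begin

definition prime_pi :: "real \<Rightarrow> nat" where
  "prime_pi x = card {p :: nat. prime p \<and> real p \<le> x}"

end

theory Submission
  imports Defs "HOL-Complex_Analysis.Complex_Analysis" "HOL-Number_Theory.Prime_Powers" "HOL-Real_Asymp.Real_Asymp"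
begin

text \<open>
  Newman's argument. Write \<open>\<Lambda>\<close> for the von Mangoldt function and
  \<open>L s = \<Sum> \<Lambda>(n) / n\<^sup>s\<close>. The function \<open>Z s = (s - 1) \<zeta>(s)\<close> is holomorphic for \<open>Re s > 0\<close>, and
  \<open>\<Lambda> * 1 = ln\<close> gives \<open>Z'/Z = 1/(s - 1) - L\<close> for \<open>Re s > 1\<close>. Hence, if \<open>m(t)\<close> is the order of \<open>Z\<close>
  at \<open>1 + it\<close> with \<open>t \<noteq> 0\<close>, then \<open>(x - 1) L(x + it) \<rightarrow> -m(t)\<close> as \<open>x\<close> decreases to 1, whereas the limit is 1
  for \<open>t = 0\<close>. Now \<open>3 + 4 cos \<theta> + cos 2\<theta> \<ge> 0\<close> forces \<open>3 - 4 m(t) - m(2t) \<ge> 0\<close>, so \<open>m(t) = 0\<close>.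

  Therefore \<open>(L s - \<zeta>(s)) / s = \<Sum> (\<psi>(n) - n) \<integral>\<^sub>n\<^sup>n\<^sup>+\<^sup>1 u\<^sup>-\<^sup>s\<^sup>-\<^sup>1 du\<close> extends holomorphically across the line
  \<open>Re s = 1\<close>. Since \<open>\<psi>(n) = O(n)\<close>, Newman's Tauberian theorem shows that the series still converges
  at \<open>s = 1\<close>, that is, \<open>\<Sum> (\<psi>(n) - n) / (n (n + 1))\<close> converges. As \<open>\<psi>\<close> is monotone, a deviation
  of \<open>\<psi>(n)\<close> from \<open>n\<close> by a factor \<open>1 \<plusminus> h\<close> would persist over a range of length \<open>h n / 2\<close> and violate
  the Cauchy criterion; so \<open>\<psi>(n) \<sim> n\<close>, which is equivalent to the claim for \<open>\<pi>(x)\<close>.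
\<close>

section \<open>Newman's Tauberian theorem\<close>

text \<open>The real part falls linearly from 0 at \<open>a\<close> to \<open>Re b = - c\<close>, so
  the exponential has norm \<open>exp (- c * y * t)\<close>. Its integral over \<open>t\<close> is
  at most \<open>1 / (c * y)\<close>, which gives decay even though the integrand does not shrink at
  \<open>a\<close> itself.\<close>

lemma contour_integral_linepath_exp_decay:
  fixes h :: "complex \<Rightarrow> complex"
  assumes h: "continuous_on (closed_segment a b) h" and "Re a = 0" "Re b < 0"
  shows "((\<lambda>y. contour_integral (linepath a b) (\<lambda>z. h z * exp (z * of_real y))) \<longlongrightarrow> 0) at_top"
proof -
  have "compact (h ` closed_segment a b)"
    using h by (intro compact_continuous_image compact_segment)
  then obtain M where M: "M > 0" "\<And>z. z \<in> closed_segment a b \<Longrightarrow> norm (h z) \<le> M"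
    using bounded_pos by (metis compact_imp_bounded imageI)
  define c where "c = - Re b"
  have c: "c > 0" using assms by (simp add: c_def)
  have bound: "norm (contour_integral (linepath a b) (\<lambda>z. h z * exp (z * of_real y)))
                 \<le> M * norm (b - a) / (c * y)" if y: "y > 0" for y
  proof -
    let ?f = "\<lambda>z. h z * exp (z * of_real y)"
    have "continuous_on (closed_segment a b) ?f"
      using h by (intro continuous_intros)
    then have "?f contour_integrable_on linepath a b"
      by (rule contour_integrable_continuous_linepath)
    then have int: "(\<lambda>x. ?f (linepath a b x) * (b - a)) integrable_on {0..1}"
      by (simp add: contour_integrable_on)
    have I: "((\<lambda>t. M * norm (b - a) * exp (- c * y * t)) has_integral
             (M * norm (b - a) * (- exp (- c * y * 1) / (c * y))
              - M * norm (b - a) * (- exp (- c * y * 0) / (c * y)))) {0..1}"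
      using c y
      by (intro fundamental_theorem_of_calculus)
         (auto intro!: derivative_eq_intros simp flip: has_real_derivative_iff_has_vector_derivative)
    have "contour_integral (linepath a b) ?f
            = integral {0..1} (\<lambda>x. ?f (linepath a b x) * (b - a))"
      by (simp add: contour_integral_integral)
    also have "norm \<dots> \<le> integral {0..1} (\<lambda>t. M * norm (b - a) * exp (- c * y * t))"
    proof (rule integral_norm_bound_integral[OF int])
      show "(\<lambda>t. M * norm (b - a) * exp (- c * y * t)) integrable_on {0..1}"
        using I by blast
      fix t :: real assume t: "t \<in> {0..1}"
      have "linepath a b t \<in> closed_segment a b"
        using t by (simp add: linepath_in_path)
      then have "norm (h (linepath a b t)) \<le> M" by (rule M)
      moreover have "Re (linepath a b t) = - c * t"
        using assms by (simp add: linepath_def c_def)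
      ultimately show "norm (?f (linepath a b t) * (b - a)) \<le> M * norm (b - a) * exp (- c * y * t)"
        using mult_right_mono[of "norm (h (linepath a b t))" M "norm (b - a) * exp (- c * y * t)"]
        by (simp add: norm_mult mult_ac)
    qed
    also have "\<dots> = M * norm (b - a) * (1 - exp (- c * y)) / (c * y)"
      unfolding integral_unique[OF I] using c y by (simp add: field_simps)
    also have "\<dots> \<le> M * norm (b - a) * 1 / (c * y)"
      using M c y by (intro divide_right_mono mult_left_mono) auto
    finally show ?thesis by simp
  qed
  have "((\<lambda>y. M * norm (b - a) / (c * y)) \<longlongrightarrow> 0) at_top"
    using c by real_asymp
  then show ?thesis
    by (rule Lim_null_comparison[rotated])
       (use bound in \<open>auto intro: eventually_mono[OF eventually_gt_at_top[of 0]]\<close>)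
qed

lemma has_contour_integral_inverse_arc:
  assumes "R > 0"
  shows "((\<lambda>z. c / z) has_contour_integral c * (\<i> * of_real (t - s))) (part_circlepath 0 R s t)"
proof -
  have nz: "part_circlepath 0 R s t x \<noteq> 0" for x
    using assms by (auto simp: part_circlepath_def)
  have eq: "c / part_circlepath 0 R s t x * vector_derivative (part_circlepath 0 R s t) (at x within {0..1})
        = c * (\<i> * of_real (t - s))" if x: "x \<in> {0..1}" for x
  proof -
    have d: "vector_derivative (part_circlepath 0 R s t) (at x within {0..1})
            = \<i> * of_real (t - s) * part_circlepath 0 R s t x"
      using x
      by (subst vector_derivative_part_circlepath01) (simp, simp, simp add: part_circlepath_def)
    have "c / u * (v * u) = c * v" if "u \<noteq> 0" for u v :: complex
      using that by simp
    from this[OF nz] show ?thesis unfolding d .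
  qed
  have "((\<lambda>x. c * (\<i> * of_real (t - s))) has_integral c * (\<i> * of_real (t - s))) {0..1::real}"
    using has_integral_const_real[of "c * (\<i> * of_real (t - s))" 0 1] by simp
  then show ?thesis
    unfolding has_contour_integral_def by (rule has_integral_eq[OF eq[symmetric], rotated])
qed

text \<open>The singularity at \<open>a\<close> is removable. The lemma serves to cancel poles: of
  \<open>F z / z\<close> at 0, of zeta at 1, and of the kernel for psi at -1.\<close>

lemma holomorphic_on_divided_difference:
  assumes "f holomorphic_on S" "open S"
  shows "(\<lambda>z. if z = a then deriv f a else (f z - f a) / (z - a)) holomorphic_on S"
proof (cases "a \<in> S")
  case True
  have deriv: "deriv (\<lambda>z. f z - f a) a = deriv f a"
    using holomorphic_on_imp_differentiable_at[OF assms True] by simp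
  show ?thesis
  proof (rule pole_theorem_open_0[of "\<lambda>z. f z - f a" S a])
    show "(\<lambda>z. f z - f a) holomorphic_on S"
      using assms by (intro holomorphic_intros)
  qed (use assms deriv in simp_all)
next
  case False
  have "(\<lambda>z. (f z - f a) / (z - a)) holomorphic_on S"
    using assms False by (intro holomorphic_intros) auto
  then show ?thesis
    by (rule holomorphic_transform) (use False in metis)
qed

text \<open>Split p z / z into the entire divided difference \<open>q\<close> and p 0 / z. Cauchy's
  theorem on a convex set kills the closed integral of \<open>q\<close>; the integral of p 0 / z
  over an arc is \<i> * p 0 times its angle, and the two angles add up to 2 pi.\<close>

lemma two_arcs_Cauchy_formula:
  assumes p: "p holomorphic_on UNIV" and R: "R > 0"
  shows "contour_integral (part_circlepath 0 R (-pi/2) (pi/2)) (\<lambda>z. p z / z) +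
         contour_integral (part_circlepath 0 R (pi/2) (3*pi/2)) (\<lambda>z. p z / z) = 2 * pi * \<i> * p 0"
    (is "contour_integral ?A _ + contour_integral ?B _ = _")
proof -
  define q where "q = (\<lambda>z. if z = 0 then deriv p 0 else (p z - p 0) / (z - 0))"
  have q: "q holomorphic_on UNIV"
    unfolding q_def using p by (intro holomorphic_on_divided_difference) auto
  have cq: "continuous_on X q" for X
    using q holomorphic_on_imp_continuous_on continuous_on_subset by blast
  have int: "q contour_integrable_on part_circlepath 0 R s t" for s t
    by (intro contour_integrable_continuous_part_circlepath cq)
  \<comment> \<open>The angles 3 pi / 2 and - pi / 2 differ by a full turn, so the joined arcs close
    up.\<close>
  have closed: "exp (\<i> * (3 * of_real pi) / 2) = exp (- (\<i> * of_real pi / 2))"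
    using cos_3over2_pi sin_3over2_pi
    by (simp add: exp_eq_polar complex_eq_iff mult.commute)
  have "(q has_contour_integral 0) (?A +++ ?B)"
    using q by (intro Cauchy_theorem_convex_simple[of _ UNIV]) (auto simp: closed)
  then have q0: "contour_integral ?A q + contour_integral ?B q = 0"
    using contour_integral_join[OF int int, of "-pi/2" "pi/2" "pi/2" "3*pi/2"]
    by (simp add: contour_integral_unique del: contour_integral_join)
  have split: "contour_integral (part_circlepath 0 R s t) (\<lambda>z. p z / z)
       = contour_integral (part_circlepath 0 R s t) q + p 0 * (\<i> * of_real (t - s))" (is "contour_integral ?g _ = _") for s t
  proof -
    have "(q has_contour_integral contour_integral ?g q) ?g"
      using int has_contour_integral_integral by blast
    from has_contour_integral_add[OF this has_contour_integral_inverse_arc[OF R, of "p 0"]]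
    have "((\<lambda>z. q z + p 0 / z) has_contour_integral (contour_integral ?g q + p 0 * (\<i> * of_real (t - s)))) ?g" .
    then have "((\<lambda>z. p z / z) has_contour_integral (contour_integral ?g q + p 0 * (\<i> * of_real (t - s)))) ?g"
    proof (rule has_contour_integral_eq)
      fix z assume "z \<in> path_image ?g"
      then have "z \<noteq> 0" using path_image_part_circlepath_subset'[of R 0 s t] R by auto
      then show "q z + p 0 / z = p z / z" by (simp add: q_def field_simps)
    qed
    then show ?thesis by (rule contour_integral_unique)
  qed
  have "contour_integral ?A (\<lambda>z. p z / z) + contour_integral ?B (\<lambda>z. p z / z)
      = p 0 * (\<i> * of_real (pi/2 - -pi/2)) + p 0 * (\<i> * of_real (3*pi/2 - pi/2))"
  proof -
    have "(x + u) + (y + v) = u + v" if "x + y = 0" for x y u v :: complex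
      using that by (simp add: algebra_simps add_eq_0_iff)
    from this[OF q0] show ?thesis unfolding split .
  qed
  also have "\<dots> = p 0 * (\<i> * of_real ((pi/2 - -pi/2) + (3*pi/2 - pi/2)))"
    by (simp only: of_real_add distrib_left)
  also have "(pi/2 - -pi/2) + (3*pi/2 - pi/2) = 2 * pi"
    by simp
  finally show ?thesis by (simp add: mult_ac)
qed

text \<open>On the circle, R^2 = z * cnj z, so the kernel equals (z + cnj z) / R^2. The resulting
  factor \<open>Re z\<close> cancels the denominator \<open>Re z\<close> in the bounds on tails and
  partial sums.\<close>

lemma norm_Newman_kernel:
  assumes "norm z = R" "R > 0"
  shows "norm ((1 + z^2 / of_real R ^ 2) / z) = 2 * \<bar>Re z\<bar> / R^2"
proof -
  have z: "z \<noteq> 0" using assms by auto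
  have "z * cnj z = of_real R ^ 2"
    using assms complex_norm_square[of z] by simp
  then have "(1 + z^2 / of_real R ^ 2) = z * (cnj z + z) / of_real R ^ 2"
    using assms by (simp add: field_simps power2_eq_square)
  then have "(1 + z^2 / of_real R ^ 2) / z = (cnj z + z) / of_real R ^ 2"
    using z by simp
  also have "cnj z + z = of_real (2 * Re z)"
    by (simp add: complex_eq_iff)
  finally show ?thesis
    by (simp add: norm_divide norm_power abs_mult del: of_real_mult)
qed

lemma Re_nonneg_arc:
  assumes "z \<in> path_image (part_circlepath 0 R (-pi/2) (pi/2))" "R > 0"
  shows "Re z \<ge> 0"
proof -
  obtain x where x: "x \<in> closed_segment (-pi/2) (pi/2)" "z = R * cis x"
    using assms by (auto simp: path_image_part_circlepath')
  then have "cos x \<ge> 0" by (intro cos_ge_zero) (auto simp: closed_segment_eq_real_ivl)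
  with x assms show ?thesis by simp
qed

lemma Re_nonpos_arc:
  assumes "z \<in> path_image (part_circlepath 0 R (pi/2) (3*pi/2))" "R > 0"
  shows "Re z \<le> 0"
proof -
  obtain x where x: "x \<in> closed_segment (pi/2) (3*pi/2)" "z = R * cis x"
    using assms by (auto simp: path_image_part_circlepath')
  then have "cos (x - pi) \<ge> 0"
    by (intro cos_ge_zero) (auto simp: closed_segment_eq_real_ivl)
  with x assms show ?thesis by (simp add: mult_nonneg_nonpos)
qed

lemma sphere_imaginary_axis:
  assumes "norm z = R" "Re z = 0"
  shows "z \<in> {\<i> * of_real R, - \<i> * of_real R}"
proof -
  have "(Im z)^2 = R^2" using assms by (auto simp: cmod_def)
  then have "Im z = R \<or> Im z = -R" by (simp add: power2_eq_iff)
  with assms show ?thesis by (auto simp: complex_eq_iff)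
qed

text \<open>\<open>U\<close> need not contain any half plane Re z > - d, but compactness of a
  segment of the imaginary axis gives a uniform margin along that segment.\<close>

lemma open_box_left_of_imaginary_axis:
  assumes "open U" "{z. Re z \<ge> 0} \<subseteq> U"
  obtains \<delta> where "\<delta> > 0" "{z. - \<delta> < Re z \<and> - b < Im z \<and> Im z < b} \<subseteq> U"
proof -
  have "compact (cbox (Complex 0 (- b)) (Complex 0 b))"
    by (rule compact_cbox)
  moreover have "cbox (Complex 0 (- b)) (Complex 0 b) \<subseteq> U"
    using assms(2) by (auto simp: in_cbox_complex_iff)
  ultimately obtain d where d: "d > 0" "(\<Union>x\<in>cbox (Complex 0 (- b)) (Complex 0 b). ball x d) \<subseteq> U"
    using compact_subset_open_imp_ball_epsilon_subset[of _ U] assms(1) by blast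
  have "z \<in> U" if "- d < Re z" "- b < Im z" "Im z < b" for z
  proof (cases "Re z \<ge> 0")
    case False
    have "Complex 0 (Im z) \<in> cbox (Complex 0 (- b)) (Complex 0 b)"
      using that by (auto simp: in_cbox_complex_iff)
    moreover have "z \<in> ball (Complex 0 (Im z)) d"
      using that False by (simp add: dist_norm cmod_def)
    ultimately show ?thesis using d by blast
  qed (use assms in auto)
  then show ?thesis using d that by blast
qed

text \<open>On the right half circle itself the exponential grows. Cauchy's theorem in a convex box
  inside \<open>U\<close> replaces the arc by two segments that meet left of the imaginary axis,
  where the exponential decays.\<close>

lemma Newman_arc_integral_tendsto_0:
  assumes h: "h holomorphic_on U" and U: "open U" "{z. Re z \<ge> 0} \<subseteq> U" and R: "R > 0"
  shows "((\<lambda>y. contour_integral (part_circlepath 0 R (-pi/2) (pi/2)) (\<lambda>z. h z * exp (z * of_real y)))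
           \<longlongrightarrow> 0) at_top"
proof -
  obtain \<delta> where \<delta>: "\<delta> > 0" "{z. - \<delta> < Re z \<and> - (R + 1) < Im z \<and> Im z < R + 1} \<subseteq> U"
    using open_box_left_of_imaginary_axis[OF U] .
  \<comment> \<open>The margin R + 1 puts the endpoints of the arc inside the open box, and the real
    part - \<delta> / 2 does the same for the corner \<open>b\<close>.\<close>
  define S where "S = {z. - \<delta> < Re z \<and> - (R + 1) < Im z \<and> Im z < R + 1}"
  define a where "a = \<i> * of_real R"
  define b :: complex where "b = - of_real (\<delta> / 2)"
  define c where "c = - \<i> * of_real R"
  let ?A = "part_circlepath 0 R (-pi/2) (pi/2)"
  have "S = {z. - \<delta> < Re z} \<inter> {z. - (R + 1) < Im z} \<inter> {z. Im z < R + 1}"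
    by (auto simp: S_def)
  then have "convex S"
    by (simp add: convex_Int convex_halfspace_Re_gt convex_halfspace_Im_gt convex_halfspace_Im_lt)
  have hS: "h holomorphic_on S" using h \<delta> holomorphic_on_subset S_def by blast
  have abc: "a \<in> S" "b \<in> S" "c \<in> S"
    using R \<delta> by (auto simp: a_def b_def c_def S_def)
  have seg: "closed_segment a b \<subseteq> S" "closed_segment c b \<subseteq> S" "closed_segment b c \<subseteq> S"
    using abc \<open>convex S\<close> by (simp_all add: closed_segment_subset)
  have AS: "path_image ?A \<subseteq> S"
  proof
    fix z assume z: "z \<in> path_image ?A"
    then have "norm z = R"
      using in_path_image_part_circlepath[OF z] R by simp
    then have "\<bar>Im z\<bar> \<le> R" using abs_Im_le_cmod[of z] by simp
    then show "z \<in> S" using Re_nonneg_arc[OF z R] \<delta> by (auto simp: S_def)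
  qed
  have cont: "continuous_on X h" if "X \<subseteq> S" for X
    using hS that holomorphic_on_imp_continuous_on continuous_on_subset by blast
  have ends: "pathstart ?A = c" "pathfinish ?A = a"
    by (simp_all add: a_def c_def exp_eq_polar complex_eq_iff)
  have eq: "contour_integral ?A (\<lambda>z. h z * exp (z * of_real y)) =
        contour_integral (linepath c b) (\<lambda>z. h z * exp (z * of_real y))
        - contour_integral (linepath a b) (\<lambda>z. h z * exp (z * of_real y))" for y
  proof -
    let ?f = "\<lambda>z. h z * exp (z * of_real y)"
    have f: "?f holomorphic_on S" using hS by (intro holomorphic_intros)
    have contf: "continuous_on X ?f" if "X \<subseteq> S" for X
      using f that holomorphic_on_imp_continuous_on continuous_on_subset by blast
    have i1: "?f contour_integrable_on ?A"
      by (intro contour_integrable_continuous_part_circlepath contf AS)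
    have i2: "?f contour_integrable_on linepath a b" "?f contour_integrable_on linepath b c"
      by (intro contour_integrable_continuous_linepath contf seg)+
    have "(?f has_contour_integral 0) (?A +++ (linepath a b +++ linepath b c))"
      using f \<open>convex S\<close>
    proof (rule Cauchy_theorem_convex_simple)
      show "valid_path (?A +++ (linepath a b +++ linepath b c))"
        using ends by (intro valid_path_join) auto
      show "path_image (?A +++ (linepath a b +++ linepath b c)) \<subseteq> S"
        using ends AS seg by (simp add: path_image_join)
      show "pathfinish (?A +++ (linepath a b +++ linepath b c)) = pathstart (?A +++ (linepath a b +++ linepath b c))"
        using ends by simp
    qed
    then have "contour_integral (?A +++ (linepath a b +++ linepath b c)) ?f = 0"
      by (rule contour_integral_unique)
    moreover have "contour_integral (?A +++ (linepath a b +++ linepath b c)) ?f =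
       contour_integral ?A ?f + (contour_integral (linepath a b) ?f + contour_integral (linepath b c) ?f)"
      using i1 i2 by (subst contour_integral_join) (auto intro!: contour_integrable_joinI)
    moreover have "contour_integral (linepath b c) ?f = - contour_integral (linepath c b) ?f"
      using contf seg by (intro contour_integral_reverse_linepath) auto
    ultimately show ?thesis by (simp add: algebra_simps)
  qed
  have "((\<lambda>y. contour_integral (linepath c b) (\<lambda>z. h z * exp (z * of_real y))
        - contour_integral (linepath a b) (\<lambda>z. h z * exp (z * of_real y))) \<longlongrightarrow> 0 - 0) at_top"
    using \<delta>
    by (intro tendsto_diff contour_integral_linepath_exp_decay cont seg) (auto simp: a_def b_def c_def)
  then show ?thesis unfolding eq by simp
qed

section \<open>The Tauberian theorem\<close>

lemma norm_sums_tail_le: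
  fixes f :: "nat \<Rightarrow> 'a :: real_normed_vector" and g :: "nat \<Rightarrow> real"
  assumes f: "f sums s" and g: "g \<longlonglongrightarrow> 0" and bound: "\<And>n. norm (f n) \<le> g n - g (Suc n)"
  shows "norm (s - (\<Sum>n<N. f n)) \<le> g N"
proof -
  have "(\<lambda>M. norm ((\<Sum>n<M. f n) - (\<Sum>n<N. f n))) \<longlonglongrightarrow> norm (s - (\<Sum>n<N. f n))"
    using f by (intro tendsto_intros) (simp add: sums_def)
  moreover have "(\<lambda>M. g N - g M) \<longlonglongrightarrow> g N - 0"
    using g by (intro tendsto_intros)
  moreover have "norm ((\<Sum>n<M. f n) - (\<Sum>n<N. f n)) \<le> g N - g M" if "M \<ge> N" for M
  proof -
    have "(\<Sum>n<M. f n) - (\<Sum>n<N. f n) = (\<Sum>n\<in>{N..<M}. f n)"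
      using that sum_diff_nat_ivl[of 0 N M f] by (simp add: atLeast0LessThan)
    also have "norm \<dots> \<le> (\<Sum>n\<in>{N..<M}. g n - g (Suc n))"
      by (intro sum_norm_le bound)
    also have "\<dots> = g N - g M"
      using that by (induction M rule: dec_induct) auto
    finally show ?thesis .
  qed
  ultimately have "norm (s - (\<Sum>n<N. f n)) \<le> g N - 0"
    by (intro tendsto_le[OF sequentially_bot]) (auto intro: eventually_mono[OF eventually_ge_at_top[of N]])
  then show ?thesis by simp
qed

text \<open>
  The norm bound is only needed on large circles around the origin. Requiring it just for \<open>norm z > 1\<close>
  spares the application below a separate argument at the removable singularity \<open>z = -1\<close>.
\<close>

theorem Newman_Tauberian:
  fixes k :: "nat \<Rightarrow> complex \<Rightarrow> complex" and l :: "nat \<Rightarrow> real"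
  assumes hol: "\<And>n. k n holomorphic_on UNIV"
    and bound: "\<And>n z. Re z \<noteq> 0 \<Longrightarrow> norm z > 1 \<Longrightarrow>
      norm (k n z) \<le> C * ((exp (- (l n * Re z)) - exp (- (l (Suc n) * Re z))) / Re z)"
    and C: "C \<ge> 0"
    and l: "filterlim l at_top sequentially"
    and F: "F holomorphic_on U" "open U" "{z. Re z \<ge> 0} \<subseteq> U"
    and sums: "\<And>z. Re z > 0 \<Longrightarrow> (\<lambda>n. k n z) sums F z"
  shows "(\<lambda>n. k n 0) sums F 0"
proof -
  define S where "S = (\<lambda>N z. \<Sum>n<N. k n z)"
  define D where "D = (\<lambda>z. if z = 0 then deriv F 0 else (F z - F 0) / (z - 0))"
  have D: "D holomorphic_on U"
    unfolding D_def using F(1,2) by (rule holomorphic_on_divided_difference)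
  have S: "S N holomorphic_on UNIV" for N
    unfolding S_def using hol by (intro holomorphic_intros)
  \<comment> \<open>The hypothesis \<open>bound\<close> says that the n-th term is at most g n - g
    (n + 1) for g n = C exp (- l n Re z) / Re z. To the right of the axis g tends to 0, so the tail
    from N on telescopes to g N.\<close>
  have tail: "norm (F z - S N z) \<le> C * (exp (- (l N * Re z)) / Re z)" if z: "Re z > 0" "norm z > 1" for N z
    unfolding S_def
  proof (rule norm_sums_tail_le[OF sums[OF z(1)]])
    have "filterlim (\<lambda>n. - (l n * Re z)) at_bot sequentially"
      using l z by (simp add: filterlim_uminus_at_bot filterlim_at_top_mult_tendsto_pos[OF tendsto_const])
    then have "(\<lambda>n. exp (- (l n * Re z))) \<longlonglongrightarrow> 0"
      by (rule filterlim_compose[OF exp_at_bot])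
    from tendsto_mult_right_zero[OF this, of "C / Re z"]
    show "(\<lambda>n. C * (exp (- (l n * Re z)) / Re z)) \<longlonglongrightarrow> 0"
      by simp
    show "norm (k n z) \<le> C * (exp (- (l n * Re z)) / Re z) - C * (exp (- (l (Suc n) * Re z)) / Re z)" for n
      using bound[of z n] z by (simp add: diff_divide_distrib right_diff_distrib)
  qed
  \<comment> \<open>To the left of the axis the same g is nonpositive, so the partial sum telescopes
    to g 0 - g N, which is at most - g N.\<close>
  have head: "norm (S N z) \<le> C * (exp (- (l N * Re z)) / \<bar>Re z\<bar>)" if z: "Re z < 0" "norm z > 1" for N z
  proof -
    define g where "g = (\<lambda>n. C * (exp (- (l n * Re z)) / Re z))"
    have "norm (S N z) \<le> (\<Sum>n<N. g n - g (Suc n))"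
      unfolding S_def using bound[of z] z
      by (intro sum_norm_le) (auto simp: g_def diff_divide_distrib right_diff_distrib)
    also have "\<dots> = g 0 - g N" by (induction N) auto
    also have "g 0 \<le> 0" using C z by (simp add: g_def mult_le_0_iff divide_le_0_iff)
    finally show ?thesis using z by (simp add: g_def)
  qed
  \<comment> \<open>The first term is small for large R, uniformly in N. For fixed R the other two
    vanish as \<open>l N\<close> grows, the last one by
    \<open>Newman_arc_integral_tendsto_0\<close>.\<close>
  have main: "2 * pi * norm (S N 0 - F 0) \<le> 4 * pi * C / R + 2 * pi * norm (F 0) / (R * l N)
     + norm (contour_integral (part_circlepath 0 R (-pi/2) (pi/2))
               (\<lambda>z. (D z * (1 + z^2 / of_real R ^ 2)) * exp (z * of_real (l N))))"
    (is "_ \<le> _ + norm ?I") if R: "R > 1" and lN: "l N > 0" for R N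
  proof -
    let ?A = "part_circlepath 0 R (-pi/2) (pi/2)" and ?B = "part_circlepath 0 R (pi/2) (3*pi/2)"
    (* Subtracting F 0 removes the pole of F z / z at the origin, so that the arc integral over the
       right half circle can be moved to the left without computing a winding number. *)
    define V where "V = (\<lambda>z::complex. 1 + z^2 / of_real R ^ 2)"
    define E where "E = (\<lambda>z::complex. exp (z * of_real (l N)))"
    \<comment> \<open>As \<open>V\<close> and \<open>E\<close> are 1 at the origin,
      \<open>P 0\<close> is the error S N 0 - F 0, which the two half circles compute.\<close>
    define P where "P = (\<lambda>z. (S N z - F 0) * V z * E z)"
    define ends where "ends = {\<i> * of_real R, - \<i> * of_real R}"
    have P: "P holomorphic_on UNIV"
      unfolding P_def V_def E_def using S R by (intro holomorphic_intros) auto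
    have A: "norm z = R" "Re z \<ge> 0" "z \<noteq> 0" "z \<in> U" if "z \<in> path_image ?A" for z
    proof -
      show *: "norm z = R" using in_path_image_part_circlepath[OF that] R by simp
      show **: "Re z \<ge> 0" using Re_nonneg_arc[OF that] R by simp
      from * R show "z \<noteq> 0" by auto
      from ** F show "z \<in> U" by auto
    qed
    have B: "norm z = R" "Re z \<le> 0" "z \<noteq> 0" if "z \<in> path_image ?B" for z
    proof -
      show *: "norm z = R" using in_path_image_part_circlepath[OF that] R by simp
      show "Re z \<le> 0" using Re_nonpos_arc[OF that] R by simp
      from * R show "z \<noteq> 0" by auto
    qed
    have cP: "continuous_on X P" for X
      using P holomorphic_on_imp_continuous_on continuous_on_subset by blast
    have iA: "(\<lambda>z. P z / z) contour_integrable_on ?A"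
      using A by (intro contour_integrable_continuous_part_circlepath continuous_intros cP) auto
    have iB: "(\<lambda>z. P z / z) contour_integrable_on ?B"
      using B by (intro contour_integrable_continuous_part_circlepath continuous_intros cP) auto
    have "continuous_on (path_image ?A) D"
      by (intro holomorphic_on_imp_continuous_on holomorphic_on_subset[OF D] subsetI A(4))
    then have iD: "(\<lambda>z. (D z * V z) * E z) contour_integrable_on ?A"
      unfolding V_def E_def using R
      by (intro contour_integrable_continuous_part_circlepath continuous_intros) auto
    have kernel: "norm (V z / z) = 2 * \<bar>Re z\<bar> / R^2" if "norm z = R" for z
      unfolding V_def using norm_Newman_kernel[OF that] R by simp
    have normE: "norm (E z) = exp (l N * Re z)" for z
      by (simp add: E_def mult.commute)

    \<comment> \<open>The terms with F 0 cancel and leave (S N z - F z) (V z / z) E z. Here the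
      exponential and the denominator \<open>Re z\<close> of the tail bound cancel against
      \<open>E\<close> and the kernel, so the bound is constant on the arc.\<close>
    have "norm (contour_integral ?A (\<lambda>z. P z / z - (D z * V z) * E z)) \<le> (2 * C / R^2) * R * (pi/2 - -pi/2)"
    proof (rule contour_integral_bound_part_circlepath_strong)
      show "(\<lambda>z. P z / z - (D z * V z) * E z) contour_integrable_on ?A"
        using iA iD by (rule contour_integrable_diff)
      show "finite ends" by (simp add: ends_def)
      fix z assume z: "z \<in> path_image ?A - ends"
      then have "Re z \<noteq> 0" using sphere_imaginary_axis[of z R] A[of z] by (auto simp: ends_def)
      then have Re: "Re z > 0" using z A(2)[of z] by simp
      have nz: "norm z = R" using z A by blast
      have "P z / z - (D z * V z) * E z = (S N z - F z) * (V z / z) * E z"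
        using z A(3)[of z] by (simp add: P_def D_def field_simps)
      then have "norm (P z / z - (D z * V z) * E z) = norm (F z - S N z) * (2 * \<bar>Re z\<bar> / R^2) * exp (l N * Re z)"
        by (simp only: norm_mult kernel[OF nz] normE norm_minus_commute)
      also have "\<dots> \<le> C * (exp (- (l N * Re z)) / Re z) * (2 * \<bar>Re z\<bar> / R^2) * exp (l N * Re z)"
        using tail[of z N] Re nz R by (intro mult_right_mono) auto
      also have "\<dots> = 2 * C / R^2"
        using Re R by (simp add: field_simps exp_minus)
      finally show "norm (P z / z - (D z * V z) * E z) \<le> 2 * C / R^2" .
    qed (use C R in auto)
    also have "\<dots> = 2 * pi * C / R"
      using R by (simp add: field_simps power2_eq_square)
    also have "contour_integral ?A (\<lambda>z. P z / z - (D z * V z) * E z)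
       = contour_integral ?A (\<lambda>z. P z / z) - contour_integral ?A (\<lambda>z. (D z * V z) * E z)"
      using iA iD by (rule contour_integral_diff)
    finally have right: "norm (contour_integral ?A (\<lambda>z. P z / z)
        - contour_integral ?A (\<lambda>z. (D z * V z) * E z)) \<le> 2 * pi * C / R" .

    \<comment> \<open>The same cancellation handles S N z. The part with F 0 leaves
      \<open>\<bar>Re z\<bar> * exp (l N * Re z)\<close>, which is at most \<open>1 / l N\<close>
      because u \<le> exp u.\<close>
    have "norm (contour_integral ?B (\<lambda>z. P z / z)) \<le>
             (2 * C / R^2 + 2 * norm (F 0) / (R^2 * l N)) * R * (3*pi/2 - pi/2)"
    proof (rule contour_integral_bound_part_circlepath_strong[OF iB])
      show "finite ends" by (simp add: ends_def)
      fix z assume z: "z \<in> path_image ?B - ends"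
      then have "Re z \<noteq> 0" using sphere_imaginary_axis[of z R] B[of z] by (auto simp: ends_def)
      then have Re: "Re z < 0" using z B(2)[of z] by simp
      have nz: "norm z = R" using z B by blast
      have "P z / z = (S N z - F 0) * (V z / z) * E z"
        by (simp add: P_def)
      then have "norm (P z / z) = norm (S N z - F 0) * (2 * \<bar>Re z\<bar> / R^2) * exp (l N * Re z)"
        by (simp only: norm_mult kernel[OF nz] normE)
      also have "\<dots> \<le> (C * (exp (- (l N * Re z)) / \<bar>Re z\<bar>) + norm (F 0)) * (2 * \<bar>Re z\<bar> / R^2) * exp (l N * Re z)"
        using head[of z N] Re nz R norm_triangle_ineq4[of "S N z" "F 0"]
        by (intro mult_right_mono) (auto simp: divide_le_0_iff)
      also have "\<dots> = 2 * C / R^2 + 2 * norm (F 0) / R^2 * (\<bar>Re z\<bar> * exp (l N * Re z))"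
        using Re R by (simp add: field_simps exp_minus)
      also have "\<bar>Re z\<bar> * exp (l N * Re z) \<le> 1 / l N"
      proof -
        have "l N * (- Re z) \<le> exp (l N * (- Re z))"
          using exp_ge_add_one_self[of "l N * (- Re z)"] by linarith
        then show ?thesis using lN Re by (simp add: exp_minus field_simps)
      qed
      then have "2 * C / R^2 + 2 * norm (F 0) / R^2 * (\<bar>Re z\<bar> * exp (l N * Re z))
                 \<le> 2 * C / R^2 + 2 * norm (F 0) / R^2 * (1 / l N)"
        by (intro add_left_mono mult_left_mono) auto
      finally show "norm (P z / z) \<le> 2 * C / R^2 + 2 * norm (F 0) / (R^2 * l N)" by simp
    qed (use C R lN in auto)
    also have "\<dots> = 2 * pi * C / R + 2 * pi * norm (F 0) / (R * l N)"
      using R lN by (simp add: field_simps power2_eq_square)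
    finally have left: "norm (contour_integral ?B (\<lambda>z. P z / z)) \<le> 2 * pi * C / R + 2 * pi * norm (F 0) / (R * l N)" .

    have "contour_integral ?A (\<lambda>z. P z / z) + contour_integral ?B (\<lambda>z. P z / z) = 2 * pi * \<i> * P 0"
      using two_arcs_Cauchy_formula[OF P, of R] R by simp
    then have "norm (2 * pi * \<i> * P 0) = norm ((contour_integral ?A (\<lambda>z. P z / z)
        - contour_integral ?A (\<lambda>z. (D z * V z) * E z)) + contour_integral ?A (\<lambda>z. (D z * V z) * E z) 
        + contour_integral ?B (\<lambda>z. P z / z))"
      by simp
    also have "\<dots> \<le> 2 * pi * C / R + norm (contour_integral ?A (\<lambda>z. (D z * V z) * E z))
              + (2 * pi * C / R + 2 * pi * norm (F 0) / (R * l N))"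
      by (intro order_trans[OF norm_triangle_ineq] add_mono right left order_refl)
    also have "norm (2 * pi * \<i> * P 0) = 2 * pi * norm (S N 0 - F 0)"
      by (simp add: P_def V_def E_def norm_mult)
    finally show ?thesis by (simp add: V_def E_def ac_simps)
  qed
  have "(\<lambda>N. S N 0) \<longlonglongrightarrow> F 0"
  proof (rule tendstoI)
    fix \<epsilon> :: real assume \<epsilon>: "\<epsilon> > 0"
    \<comment> \<open>This choice makes the term 4 pi C / R at most half of pi * \<epsilon>; the
      remaining terms take the other half for large N. The 2 secures R > 1, where the norm bounds
      hold on the circle.\<close>
    define R where "R = max 2 (8 * C / \<epsilon>)"
    have R: "R > 1" "8 * C / \<epsilon> \<le> R" by (auto simp: R_def)
    then have CR: "4 * pi * C / R \<le> pi * \<epsilon> / 2" using \<epsilon> by (simp add: field_simps)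
    let ?I = "\<lambda>y. contour_integral (part_circlepath 0 R (-pi/2) (pi/2))
               (\<lambda>z. (D z * (1 + z^2 / of_real R ^ 2)) * exp (z * of_real y))"
    have "(?I \<longlongrightarrow> 0) at_top"
      using R D F by (intro Newman_arc_integral_tendsto_0[of _ U] holomorphic_intros) auto
    moreover have "((\<lambda>y. 2 * pi * norm (F 0) / (R * y)) \<longlongrightarrow> 0) at_top"
      using R by real_asymp
    ultimately have "((\<lambda>y. 2 * pi * norm (F 0) / (R * y) + norm (?I y)) \<longlongrightarrow> 0) at_top"
      using tendsto_add[OF _ tendsto_norm_zero] by fastforce
    then have "((\<lambda>N. 2 * pi * norm (F 0) / (R * l N) + norm (?I (l N))) \<longlongrightarrow> 0) sequentially"
      by (rule filterlim_compose[OF _ l])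
    then have "\<forall>\<^sub>F N in sequentially. 2 * pi * norm (F 0) / (R * l N) + norm (?I (l N)) < pi * \<epsilon> / 2"
      using \<epsilon> by (intro order_tendstoD) auto
    moreover have "\<forall>\<^sub>F N in sequentially. l N > 0"
      using l by (simp add: filterlim_at_top_dense)
    ultimately show "\<forall>\<^sub>F N in sequentially. dist (S N 0) (F 0) < \<epsilon>"
    proof eventually_elim
      case (elim N)
      have "2 * pi * norm (S N 0 - F 0) < pi * \<epsilon> / 2 + pi * \<epsilon> / 2"
        using main[OF R(1) elim(2)] CR elim(1) by linarith
      then have "pi * (2 * norm (S N 0 - F 0)) < pi * \<epsilon>" by simp
      then show ?case using \<epsilon> by (simp add: dist_norm)
    qed
  qed
  then show ?thesis by (simp add: sums_def S_def)
qed

section \<open>Dirichlet series\<close>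

lemma norm_of_nat_powr [simp]: "norm (of_nat n powr s :: complex) = real n powr Re s"
  by (cases "n = 0") (auto simp: norm_powr_real_powr)

lemma has_vector_derivative_of_real_powr:
  assumes "t > 0"
  shows "((\<lambda>t. of_real t powr s :: complex) has_vector_derivative s * of_real t powr (s - 1)) (at t)"
proof -
  have "((\<lambda>z. z powr s) has_field_derivative s * of_real t powr (s - 1)) (at (of_real t :: complex))"
    using assms by (intro has_field_derivative_powr) auto
  then show ?thesis by (rule has_vector_derivative_real_field)
qed

lemma has_field_derivative_of_nat_powr:
  fixes s :: complex
  shows "((\<lambda>s. of_nat n powr (- s)) has_field_derivative - of_real (ln (real n)) * of_nat n powr (- s)) (at s)"
proof (cases "n = 0")
  case False
  then have "Ln (of_nat n) = complex_of_real (ln (real n))"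
    by simp
  with False show ?thesis
    by (auto intro!: derivative_eq_intros simp: powr_def)
qed simp

text \<open>Since \<open>0 powr z = 0\<close>, the index 0 contributes nothing, whatever
  \<open>a 0\<close> is.\<close>

definition dirichlet :: "(nat \<Rightarrow> complex) \<Rightarrow> complex \<Rightarrow> complex" where
  "dirichlet a s = (\<Sum>n. a n * of_nat n powr (- s))"

text \<open>Absolute convergence permits summing f m * g d in any order, and (m, d) \<mapsto> (m d,
  d) reindexes the pairs by their product. The sums run over positive indices because 0 has
  infinitely many divisors.\<close>

lemma dirichlet_mult:
  assumes a: "summable (\<lambda>n. norm (a n * of_nat n powr (- s)))"
    and b: "summable (\<lambda>n. norm (b n * of_nat n powr (- s)))"
  shows "dirichlet a s * dirichlet b s = dirichlet (\<lambda>n. \<Sum>d | d dvd n. a (n div d) * b d) s"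
proof -
  define f where "f = (\<lambda>n. a n * of_nat n powr (- s))"
  define g where "g = (\<lambda>n. b n * of_nat n powr (- s))"
  have pos: "(h has_sum c) {0<..} \<longleftrightarrow> (h has_sum c) UNIV" if "h 0 = 0" for h :: "nat \<Rightarrow> complex" and c
    using that by (intro has_sum_cong_neutral) auto
  have "f sums dirichlet a s" "g sums dirichlet b s"
    using summable_norm_cancel[OF a] summable_norm_cancel[OF b]
    by (simp_all add: dirichlet_def f_def g_def summable_sums)
  then have F: "(f has_sum dirichlet a s) {0<..}" and G: "(g has_sum dirichlet b s) {0<..}"
    using a b by (auto simp: pos f_def g_def intro!: norm_summable_imp_has_sum)
  have "(\<lambda>n. norm (f n)) summable_on {0<..}" "(\<lambda>n. norm (g n)) summable_on {0<..}"
    using a b unfolding f_def g_def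
    by (auto intro!: summable_on_subset_banach[OF norm_summable_imp_summable_on])
  then have "(\<lambda>x. norm (case x of (m, d) \<Rightarrow> f m * g d)) summable_on {0<..} \<times> {0<..}"
    by (subst Infinite_Sum.abs_summable_on_Sigma_iff)
       (auto simp: norm_mult infsum_cmult_right' abs_mult intro!: summable_on_cmult_right summable_on_cmult_left)
  then have summable: "(\<lambda>(m, d). f m * g d) summable_on {0<..} \<times> {0<..}"
    by (rule abs_summable_summable)
  have "((\<lambda>(m, d). f m * g d) has_sum (dirichlet a s * dirichlet b s)) ({0<..} \<times> {0<..})"
  proof (rule has_sum_SigmaI[OF _ _ summable])
    show "((\<lambda>d. case (m, d) of (m, d) \<Rightarrow> f m * g d) has_sum (f m * dirichlet b s)) {0<..}" for m
      using G by (simp add: has_sum_cmult_right)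
    show "((\<lambda>m. f m * dirichlet b s) has_sum (dirichlet a s * dirichlet b s)) {0<..}"
      using F by (rule has_sum_cmult_left)
  qed
  also have "?this \<longleftrightarrow> ((\<lambda>(n, d). f (n div d) * g d) has_sum (dirichlet a s * dirichlet b s))
                         (SIGMA n:{0<..}. {d. d dvd n})"
    by (rule has_sum_reindex_bij_witness[where i = "\<lambda>(n, d). (n div d, d)" and j = "\<lambda>(m, d). (m * d, d)"])
       (auto elim!: dvdE intro: Nat.gr0I)
  finally have "((\<lambda>n. \<Sum>d | d dvd n. f (n div d) * g d) has_sum (dirichlet a s * dirichlet b s)) {0<..}"
    by (rule has_sum_SigmaD) (auto intro!: has_sum_finiteI)
  also have "?this \<longleftrightarrow> ((\<lambda>n. (\<Sum>d | d dvd n. a (n div d) * b d) * of_nat n powr (- s))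
                         has_sum (dirichlet a s * dirichlet b s)) {0<..}"
  proof (rule has_sum_cong)
    fix n :: nat assume n: "n \<in> {0<..}"
    have "f (n div d) * g d = a (n div d) * b d * of_nat n powr (- s)" if "d dvd n" for d
    proof -
      have "of_nat (n div d) powr (- s) * of_nat d powr (- s) = (of_nat (n div d) * of_nat d :: complex) powr (- s)"
        by (subst powr_times_real) auto
      also have "of_nat (n div d) * of_nat d = (of_nat n :: complex)"
        using that by (simp flip: of_nat_mult)
      finally show ?thesis by (simp add: f_def g_def mult_ac)
    qed
    then show "(\<Sum>d | d dvd n. f (n div d) * g d) = (\<Sum>d | d dvd n. a (n div d) * b d) * of_nat n powr (- s)"
      by (simp add: sum_distrib_right)
  qed
  also have "\<dots> \<longleftrightarrow> ((\<lambda>n. (\<Sum>d | d dvd n. a (n div d) * b d) * of_nat n powr (- s))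
                         has_sum (dirichlet a s * dirichlet b s)) UNIV"
    by (intro pos) auto
  finally show ?thesis
    by (auto dest!: has_sum_imp_sums simp: dirichlet_def sums_iff)
qed

lemma summable_ln_mult_powr:
  assumes "x > 1"
  shows "summable (\<lambda>n. (1 + ln (real n)) * real n powr (- x))"
proof (rule summable_comparison_test_ev)
  \<comment> \<open>Half of the excess of \<open>x\<close> over 1 absorbs the logarithm, via ln n
    \<le> n^e / e, and half keeps the series convergent: e - x = - (1 + e).\<close>
  define e where "e = (x - 1) / 2"
  have e: "e > 0" using assms by (simp add: e_def)
  show "summable (\<lambda>n. (1 + 1 / e) * real n powr (- (1 + e)))"
    using e by (intro summable_mult) (simp add: summable_real_powr_iff)
  show "\<forall>\<^sub>F n in sequentially. norm ((1 + ln (real n)) * real n powr (- x)) \<le> (1 + 1 / e) * real n powr (- (1 + e))"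
    using eventually_ge_at_top[of 1]
  proof eventually_elim
    case (elim n)
    have "1 + ln (real n) \<le> real n powr e + real n powr e / e"
      using elim e by (intro add_mono ln_powr_bound ge_one_powr_ge_zero) auto
    then have "(1 + ln (real n)) * real n powr (- x) \<le> (real n powr e + real n powr e / e) * real n powr (- x)"
      by (intro mult_right_mono) auto
    also have "\<dots> = (1 + 1 / e) * (real n powr e * real n powr (- x))"
      by (simp add: algebra_simps)
    also have "real n powr e * real n powr (- x) = real n powr (- (1 + e))"
      by (simp add: e_def flip: powr_add) (simp add: field_simps)
    finally show ?case using elim by (simp add: abs_mult)
  qed
qed

text \<open>The bound 1 + ln n is chosen to cover all three coefficient sequences in use: 1, ln n
  and the von Mangoldt function.\<close>

lemma dirichlet_abs_convergent:
  assumes a: "\<And>n. n > 0 \<Longrightarrow> norm (a n) \<le> 1 + ln (real n)" and s: "Re s > 1"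
  shows "summable (\<lambda>n. norm (a n * of_nat n powr (- s)))"
proof (rule summable_comparison_test[OF _ summable_ln_mult_powr[OF s]], intro exI allI impI)
  fix n :: nat
  show "norm (norm (a n * of_nat n powr (- s))) \<le> (1 + ln (real n)) * real n powr (- Re s)"
    using a[of n] by (cases "n = 0") (auto simp: norm_mult intro!: mult_right_mono)
qed

lemma dirichlet_sums:
  assumes "\<And>n. n > 0 \<Longrightarrow> norm (a n) \<le> 1 + ln (real n)" and "Re s > 1"
  shows "(\<lambda>n. a n * of_nat n powr (- s)) sums dirichlet a s"
  unfolding dirichlet_def
  by (rule summable_sums, rule summable_norm_cancel, rule dirichlet_abs_convergent) (use assms in simp_all)

lemma dirichlet_has_field_derivative:
  assumes a: "\<And>n. n > 0 \<Longrightarrow> norm (a n) \<le> 1 + ln (real n)" and s: "Re s > 1"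
  shows "(dirichlet a has_field_derivative dirichlet (\<lambda>n. - of_real (ln (real n)) * a n) s) (at s)"
proof -
  let ?S = "{s. Re s > 1}"
  have "\<exists>g g'. \<forall>s \<in> ?S. ((\<lambda>n. a n * of_nat n powr (- s)) sums g s) \<and>
      ((\<lambda>n. a n * (- of_real (ln (real n)) * of_nat n powr (- s))) sums g' s) \<and> (g has_field_derivative g' s) (at s)"
  proof (rule series_and_derivative_comparison_local)
    show "open ?S" by (rule open_halfspace_Re_gt)
    show "((\<lambda>s. a n * of_nat n powr (- s)) has_field_derivative
             a n * (- of_real (ln (real n)) * of_nat n powr (- s))) (at s)" for n s
      by (intro DERIV_cmult has_field_derivative_of_nat_powr)
    fix s assume "s \<in> ?S"
    then have s: "Re s > 1" by simp
    \<comment> \<open>The midpoint of 1 and Re s: on the ball of radius x - 1 = Re s - x around s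
      all real parts stay above x, which gives a common summable majorant.\<close>
    define x where "x = (1 + Re s) / 2"
    have x: "x > 1" using s by (simp add: x_def)
    have "norm (a n * of_nat n powr (- w)) \<le> (1 + ln (real n)) * real n powr (- x)"
      if "w \<in> ball s (x - 1)" for n w
    proof (cases "n = 0")
      case False
      have "\<bar>Re (s - w)\<bar> < x - 1" using that abs_Re_le_cmod[of "s - w"] by (simp add: dist_norm)
      then have "Re w \<ge> x" by (simp add: x_def field_simps abs_if split: if_splits)
      then have "norm (a n) * real n powr (- Re w) \<le> (1 + ln (real n)) * real n powr (- x)"
        using False a by (intro mult_mono powr_mono) auto
      then show ?thesis by (simp add: norm_mult)
    qed simp
    then show "\<exists>d h. 0 < d \<and> summable h \<and>
        (\<forall>\<^sub>F n in sequentially. \<forall>w\<in>ball s d \<inter> ?S. norm (a n * of_nat n powr (- w)) \<le> h n)"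
      using x summable_ln_mult_powr[OF x]
      by (intro exI[of _ "x - 1"] exI[of _ "\<lambda>n. (1 + ln (real n)) * real n powr (- x)"]) auto
  qed
  then obtain g g' where g: "\<And>s. s \<in> ?S \<Longrightarrow> (\<lambda>n. a n * of_nat n powr (- s)) sums g s"
    "\<And>s. s \<in> ?S \<Longrightarrow> (\<lambda>n. a n * (- of_real (ln (real n)) * of_nat n powr (- s))) sums g' s"
    "\<And>s. s \<in> ?S \<Longrightarrow> (g has_field_derivative g' s) (at s)" by blast
  have g_eq: "g s = dirichlet a s" if "s \<in> ?S" for s
    using g(1)[OF that] by (simp add: dirichlet_def sums_iff)
  have s': "s \<in> ?S" using s by simp
  have "(\<lambda>n. a n * (- of_real (ln (real n)) * of_nat n powr (- s)))
          = (\<lambda>n. (- of_real (ln (real n)) * a n) * of_nat n powr (- s))"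
    by (rule ext) (rule mult.left_commute[THEN trans], rule mult.assoc[symmetric])
  with g(2)[OF s'] have "g' s = dirichlet (\<lambda>n. - of_real (ln (real n)) * a n) s"
    unfolding dirichlet_def by (metis sums_unique)
  moreover have "(dirichlet a has_field_derivative g' s) (at s)"
    by (rule has_field_derivative_transform_within_open[OF g(3)[OF s'] open_halfspace_Re_gt s' g_eq])
  ultimately show ?thesis by simp
qed

section \<open>The zeta function\<close>

text \<open>
  For \<open>n > 0\<close> this is \<open>s - 1\<close> times the difference of \<open>n\<^sup>-\<^sup>s\<close> and \<open>\<integral>\<^sub>n\<^sup>n\<^sup>+\<^sup>1 t\<^sup>-\<^sup>s dt\<close>; the factor makes it entire.
  As \<open>0 powr z = 0\<close>, the term for \<open>n = 0\<close> is the constant 1. The sum over all \<open>n\<close> is \<open>(s - 1) \<zeta>(s)\<close>.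
\<close>

definition zeta_term :: "nat \<Rightarrow> complex \<Rightarrow> complex" where
  "zeta_term n s = (s - 1) * of_nat n powr (- s) - of_nat n powr (1 - s) + of_nat (Suc n) powr (1 - s)"

definition zeta_reg :: "complex \<Rightarrow> complex" where
  "zeta_reg s = (\<Sum>n. zeta_term n s)"

text \<open>The mean value inequality is applied twice. The term is the increment over [n, n + 1] of
  \<open>?f\<close>, whose derivative is (1 - s) (t^-s - n^-s); the difference of powers is in turn
  at most \<open>B\<close>. This gains one power of n over the single terms n^-s, hence convergence
  down to Re s > 0.\<close>

lemma norm_zeta_term_le:
  assumes n: "n > 0" and s: "Re s > 0"
  shows "norm (zeta_term n s) \<le> norm (s - 1) * norm s * real n powr (- 1 - Re s)"
proof -
  define B where "B = norm s * real n powr (- 1 - Re s)"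
  have B: "norm (of_real t powr (- s) - of_real (real n) powr (- s)) \<le> B" if t: "real n < t" "t \<le> real n + 1" for t
  proof -
    have "norm (of_real t powr (- s) - of_real (real n) powr (- s)) \<le> B * t - B * real n"
    proof (rule differentiable_bound_general[OF t(1)])
      show "((\<lambda>t. of_real t powr (- s)) has_vector_derivative (- s) * of_real u powr (- s - 1)) (at u)" if "real n < u" for u
        using that n by (intro has_vector_derivative_of_real_powr) auto
      show "((*) B has_vector_derivative B) (at u)" for u
        by (auto intro!: derivative_eq_intros simp flip: has_real_derivative_iff_has_vector_derivative)
      show "norm ((- s) * of_real u powr (- s - 1)) \<le> B" if "real n < u" for u
      proof -
        have "u powr (- Re s - 1) \<le> real n powr (- Re s - 1)"
          using that n s by (intro powr_mono2') auto
        then show ?thesis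
          using that n by (simp add: norm_mult norm_powr_real_powr B_def mult_left_mono minus_diff_commute)
      qed
    qed (use n in \<open>auto intro!: continuous_intros\<close>)
    also have "\<dots> = B * (t - real n)" by (simp add: algebra_simps)
    also have "\<dots> \<le> B * 1" using t by (intro mult_left_mono) (auto simp: B_def)
    finally show ?thesis by simp
  qed
  let ?f = "\<lambda>t. (s - 1) * of_real (real n) powr (- s) * of_real t + of_real t powr (1 - s)"
  let ?f' = "\<lambda>t. (s - 1) * of_real (real n) powr (- s) + (1 - s) * of_real t powr (1 - s - 1)"
  have "norm (?f (real n + 1) - ?f (real n)) \<le> norm (s - 1) * B * (real n + 1) - norm (s - 1) * B * real n"
  proof (rule differentiable_bound_general)
    show "(?f has_vector_derivative ?f' u) (at u)" if "real n < u" for u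
      using that n
      by (intro has_vector_derivative_add has_vector_derivative_of_real_powr)
         (auto intro!: derivative_eq_intros)
    show "((*) (norm (s - 1) * B) has_vector_derivative norm (s - 1) * B) (at u)" for u
      by (auto intro!: derivative_eq_intros simp flip: has_real_derivative_iff_has_vector_derivative)
    show "norm (?f' u) \<le> norm (s - 1) * B" if "real n < u" "u < real n + 1" for u
    proof -
      have "?f' u = (1 - s) * (of_real u powr (- s) - of_real (real n) powr (- s))"
        by (simp add: algebra_simps)
      then show ?thesis using B[of u] that by (simp add: norm_mult norm_minus_commute mult_left_mono)
    qed
  qed (use n in \<open>auto intro!: continuous_intros\<close>)
  also have "?f (real n + 1) - ?f (real n) = zeta_term n s"
    by (simp add: zeta_term_def algebra_simps)
  finally show ?thesis by (simp add: B_def algebra_simps)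
qed

lemma zeta_reg_holomorphic: "zeta_reg holomorphic_on {s. Re s > 0}"
proof -
  let ?S = "{s. Re s > 0}"
  have hol: "zeta_term n holomorphic_on UNIV" for n
  proof (cases "n = 0")
    case False
    then show ?thesis unfolding zeta_term_def by (intro holomorphic_intros)
  next
    case True
    then have "zeta_term n = (\<lambda>_. 1)" by (auto simp: zeta_term_def)
    then show ?thesis by simp
  qed
  have "\<exists>g g'. \<forall>s \<in> ?S. (\<lambda>n. zeta_term n s) sums g s \<and>
      (\<lambda>n. deriv (zeta_term n) s) sums g' s \<and> (g has_field_derivative g' s) (at s)"
  proof (rule series_and_derivative_comparison_local)
    show "open ?S" by (rule open_halfspace_Re_gt)
    show "(zeta_term n has_field_derivative deriv (zeta_term n) s) (at s)" for n s
      using hol[of n] by (intro holomorphic_derivI[of _ UNIV]) auto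
    fix s assume "s \<in> ?S"
    then have s: "Re s > 0" by simp
    define x where "x = Re s / 2"
    have x: "x > 0" using s by (simp add: x_def)
    define h where "h = (\<lambda>n. (norm s + x + 1) * (norm s + x) * real n powr (- 1 - x))"
    have "norm (zeta_term n w) \<le> h n" if w: "w \<in> ball s x" and n: "n > 0" for n w
    proof -
      have "\<bar>Re (s - w)\<bar> < x" using w abs_Re_le_cmod[of "s - w"] by (simp add: dist_norm)
      then have Re: "Re w \<ge> x" by (simp add: x_def field_simps abs_if split: if_splits)
      have norm: "norm w \<le> norm s + x"
        using w norm_triangle_ineq2[of w s] by (simp add: dist_norm norm_minus_commute)
      then have norm1: "norm (w - 1) \<le> norm s + x + 1"
        using norm_triangle_ineq4[of w 1] by simp
      have "norm (zeta_term n w) \<le> norm (w - 1) * norm w * real n powr (- 1 - Re w)"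
        using Re x n by (intro norm_zeta_term_le) auto
      also have "\<dots> \<le> h n"
        unfolding h_def using Re norm norm1 n x by (intro mult_mono powr_mono) auto
      finally show ?thesis .
    qed
    then have "\<forall>\<^sub>F n in sequentially. \<forall>w\<in>ball s x \<inter> ?S. norm (zeta_term n w) \<le> h n"
      by (auto intro: eventually_mono[OF eventually_gt_at_top[of 0]])
    moreover have "summable h"
      unfolding h_def using x by (intro summable_mult) (simp add: summable_real_powr_iff)
    ultimately show "\<exists>d h. 0 < d \<and> summable h \<and>
        (\<forall>\<^sub>F n in sequentially. \<forall>w\<in>ball s d \<inter> ?S. norm (zeta_term n w) \<le> h n)"
      using x by blast
  qed
  then obtain g g' where g: "\<And>s. s \<in> ?S \<Longrightarrow> (\<lambda>n. zeta_term n s) sums g s"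
    "\<And>s. s \<in> ?S \<Longrightarrow> (g has_field_derivative g' s) (at s)" by blast
  have g_eq: "g s = zeta_reg s" if "s \<in> ?S" for s
    using g(1)[OF that] by (simp add: zeta_reg_def sums_iff)
  have "g holomorphic_on ?S"
    using g(2) by (auto simp: holomorphic_on_open open_halfspace_Re_gt)
  then show "zeta_reg holomorphic_on ?S"
    by (rule holomorphic_transform) (rule g_eq)
qed

lemma zeta_reg_1 [simp]: "zeta_reg 1 = 1"
proof -
  have "zeta_term n 1 = (if n = 0 then 1 else 0)" for n
    by (simp add: zeta_term_def del: of_nat_Suc)
  then have "(\<lambda>n. zeta_term n 1) sums 1"
    using sums_single[of 0 "\<lambda>_. 1::complex"] by (simp cong: if_cong)
  then show ?thesis by (simp add: zeta_reg_def sums_iff)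
qed

lemma of_nat_powr_tendsto_0:
  assumes "Re s < 0"
  shows "(\<lambda>n. of_nat n powr s :: complex) \<longlonglongrightarrow> 0"
proof -
  have "(\<lambda>n. norm (of_nat n powr s :: complex)) \<longlonglongrightarrow> 0"
    unfolding norm_of_nat_powr using assms by real_asymp
  then show ?thesis by (rule tendsto_norm_zero_cancel)
qed

text \<open>The powers n^(1 - s) telescope in the partial sums; the one left over, N^(1 - s), tends
  to 0 as Re s > 1.\<close>

lemma zeta_reg_eq_dirichlet:
  assumes s: "Re s > 1"
  shows "zeta_reg s = (s - 1) * dirichlet (\<lambda>_. 1) s"
proof -
  have "(\<Sum>n<N. zeta_term n s) = (s - 1) * (\<Sum>n<N. of_nat n powr (- s)) + of_nat N powr (1 - s)" for N
    by (induction N) (simp_all add: zeta_term_def algebra_simps)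
  moreover have "(\<lambda>n. of_nat n powr (- s)) sums dirichlet (\<lambda>_. 1) s"
    using dirichlet_sums[of "\<lambda>_. 1" s] s by simp
  then have "(\<lambda>N. (s - 1) * (\<Sum>n<N. of_nat n powr (- s)) + of_nat N powr (1 - s))
      \<longlonglongrightarrow> (s - 1) * dirichlet (\<lambda>_. 1) s + 0"
    using s by (intro tendsto_add tendsto_mult tendsto_const of_nat_powr_tendsto_0) (auto simp: sums_def)
  ultimately have "(\<lambda>n. zeta_term n s) sums ((s - 1) * dirichlet (\<lambda>_. 1) s)"
    by (simp add: sums_def)
  then show ?thesis by (simp add: zeta_reg_def sums_iff)
qed

lemma norm_mangoldt_le: "n > 0 \<Longrightarrow> norm (mangoldt n :: complex) \<le> 1 + ln (real n)"
  using mangoldt_le[of n] by simp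

text \<open>The convolution of 1 and the von Mangoldt function is ln, and differentiating the series
  brings down - ln n; the rest is the product rule. The equation is free of division by
  \<open>zeta_reg s\<close> because the non-vanishing for Re s > 1 is itself deduced from
  it.\<close>

lemma deriv_zeta_reg:
  assumes s: "Re s > 1"
  shows "deriv zeta_reg s = zeta_reg s * (1 / (s - 1) - dirichlet mangoldt s)"
proof -
  let ?D = "dirichlet (\<lambda>_. 1)"
  have s1: "s \<noteq> 1" using s by auto
  have "(?D has_field_derivative dirichlet (\<lambda>n. - of_real (ln (real n)) * 1) s) (at s)"
    using s by (intro dirichlet_has_field_derivative) auto
  also have "dirichlet (\<lambda>n. - of_real (ln (real n)) * 1) s = - dirichlet (\<lambda>n. of_real (ln (real n))) s"
    unfolding dirichlet_def
  proof (subst suminf_minus [symmetric])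
    have "norm (of_real (ln (real n)) :: complex) \<le> 1 + ln (real n)" if "n > 0" for n
      using that by simp
    from dirichlet_abs_convergent[OF this s]
    show "summable (\<lambda>n. of_real (ln (real n)) * of_nat n powr - s)"
      by (rule summable_norm_cancel)
  qed simp
  also have "dirichlet (\<lambda>n. of_real (ln (real n))) s = ?D s * dirichlet mangoldt s"
  proof -
    have "?D s * dirichlet mangoldt s = dirichlet (\<lambda>n. \<Sum>d | d dvd n. 1 * mangoldt d) s"
      using s by (intro dirichlet_mult dirichlet_abs_convergent norm_mangoldt_le) auto
    also have "\<dots> = dirichlet (\<lambda>n. of_real (ln (real n))) s"
      unfolding dirichlet_def
    proof (intro suminf_cong)
      show "(\<Sum>d | d dvd n. 1 * mangoldt d) * of_nat n powr - s = of_real (ln (real n)) * of_nat n powr - s" for n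
        by (cases "n = 0") (auto simp: mangoldt_sum)
    qed
    finally show ?thesis by simp
  qed
  finally have "((\<lambda>s. (s - 1) * ?D s) has_field_derivative ?D s + (s - 1) * (- (?D s * dirichlet mangoldt s))) (at s)"
    by (auto intro!: derivative_eq_intros)
  then have "(zeta_reg has_field_derivative ?D s + (s - 1) * (- (?D s * dirichlet mangoldt s))) (at s)"
    by (rule has_field_derivative_transform_within_open[OF _ open_halfspace_Re_gt[of 1]])
       (use s in \<open>auto simp: zeta_reg_eq_dirichlet\<close>)
  then show ?thesis
    using s1 by (simp add: DERIV_imp_deriv zeta_reg_eq_dirichlet[OF s] field_simps)
qed

section \<open>Orders of zeros and non-vanishing for Re s \<ge> 1\<close>

text \<open>Write f w = (w - a)^m * g w with g zero-free near a. The logarithmic derivative is then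
  m / (w - a) plus that of g, which stays bounded near a. The case m = 0 takes g = f.\<close>

lemma logderiv_tendsto_order:
  assumes f: "f holomorphic_on S" and S: "open S" "connected S" "a \<in> S" and nc: "\<not> f constant_on S"
  obtains m :: nat where "m = 0 \<longleftrightarrow> f a \<noteq> 0" "\<forall>\<^sub>F w in at a. f w \<noteq> 0"
    "((\<lambda>w. (w - a) * (deriv f w / f w)) \<longlongrightarrow> of_nat m) (at a)"
proof -
  obtain g r and m :: nat where r: "r > 0" "ball a r \<subseteq> S" and g: "g holomorphic_on ball a r"
    and fg: "\<And>w. w \<in> ball a r \<Longrightarrow> f w = (w - a) ^ m * g w"
    and g0: "\<And>w. w \<in> ball a r \<Longrightarrow> g w \<noteq> 0" and m: "m = 0 \<longleftrightarrow> f a \<noteq> 0"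
  proof (cases "f a = 0")
    case True
    from holomorphic_factor_zero_nonconstant[OF f S this nc]
    obtain g r m where "0 < (m::nat)" "0 < r" "ball a r \<subseteq> S" "g holomorphic_on ball a r"
      "\<And>w. w \<in> ball a r \<Longrightarrow> f w = (w - a) ^ m * g w" "\<And>w. w \<in> ball a r \<Longrightarrow> g w \<noteq> 0"
      by metis
    then show ?thesis using True that[of r g m] by simp
  next
    case False
    have "continuous_on S f" using f by (rule holomorphic_on_imp_continuous_on)
    then have "open {w \<in> S. f w \<noteq> 0}"
      using S continuous_open_preimage[of S f "- {0}"] by (simp add: vimage_def Int_def open_Compl)
    then obtain r where "r > 0" "ball a r \<subseteq> {w \<in> S. f w \<noteq> 0}"
      using False S by (metis (mono_tags, lifting) mem_Collect_eq openE)
    then show ?thesis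
      by (intro that[of r f 0]) (use False f in \<open>auto intro: holomorphic_on_subset\<close>)
  qed
  have near: "\<forall>\<^sub>F w in at a. w \<in> ball a r - {a}"
    using r eventually_at_in_open[of "ball a r" a] by simp
  have "\<forall>\<^sub>F w in at a. of_nat m + (w - a) * (deriv g w / g w) = (w - a) * (deriv f w / f w)"
    using near
  proof eventually_elim
    case (elim w)
    have w: "w \<in> ball a r" "w \<noteq> a" using elim by auto
    have dg: "(g has_field_derivative deriv g w) (at w)"
      using g w by (intro holomorphic_derivI) auto
    have "((\<lambda>w. (w - a) ^ m * g w) has_field_derivative
             (of_nat m * (w - a) ^ (m - 1) * g w + deriv g w * (w - a) ^ m)) (at w)"
      using dg by (auto intro!: derivative_eq_intros)
    then have "(f has_field_derivative
             (of_nat m * (w - a) ^ (m - 1) * g w + deriv g w * (w - a) ^ m)) (at w)"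
      by (rule has_field_derivative_transform_within_open[of _ _ _ "ball a r"]) (use w fg in auto)
    then have "deriv f w = of_nat m * (w - a) ^ (m - 1) * g w + deriv g w * (w - a) ^ m"
      by (rule DERIV_imp_deriv)
    then have "(w - a) * deriv f w = ((w - a) * (of_nat m * (w - a) ^ (m - 1))) * g w + (w - a) * deriv g w * (w - a) ^ m"
      by (simp only: distrib_left mult.assoc)
    \<comment> \<open>For m = 0 the exponent m - 1 is truncated to 0, but the factor
      \<open>of_nat m\<close> makes both sides vanish.\<close>
    also have "(w - a) * (of_nat m * (w - a) ^ (m - 1)) = of_nat m * (w - a) ^ m"
      by (cases m) auto
    also have "of_nat m * (w - a) ^ m * g w + (w - a) * deriv g w * (w - a) ^ m
        = of_nat m * f w + (w - a) * (deriv g w / g w) * f w"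
      using g0[OF w(1)] fg[OF w(1)] by simp
    finally have "(w - a) * deriv f w = of_nat m * f w + (w - a) * (deriv g w / g w) * f w" .
    moreover have "f w \<noteq> 0" using w g0 fg by simp
    ultimately show ?case by (simp add: field_simps)
  qed
  moreover have "((\<lambda>w. of_nat m + (w - a) * (deriv g w / g w)) \<longlongrightarrow> of_nat m + (a - a) * (deriv g a / g a)) (at a)"
  proof -
    have "isCont g a" "isCont (deriv g) a"
      using g r holomorphic_deriv[OF g] 
      by (auto simp: continuous_on_eq_continuous_at[symmetric] dest!: holomorphic_on_imp_continuous_on
               intro: continuous_on_interior)
    then show ?thesis
      using g0[of a] r by (intro tendsto_intros) (auto simp: isCont_def)
  qed
  ultimately have "((\<lambda>w. (w - a) * (deriv f w / f w)) \<longlongrightarrow> of_nat m + (a - a) * (deriv g a / g a)) (at a)"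
    by (rule Lim_transform_eventually[rotated])
  moreover have "\<forall>\<^sub>F w in at a. f w \<noteq> 0"
    using near by eventually_elim (use fg g0 in auto)
  ultimately show ?thesis using that[of m] m by simp
qed

text \<open>If \<open>zeta_reg\<close> is constant, its value is \<open>zeta_reg 1 = 1\<close> and m
  = 0 works; otherwise the general lemma applies on the connected half plane.\<close>

lemma zeta_reg_order:
  assumes "Re a > 0"
  obtains m :: nat where "m = 0 \<longleftrightarrow> zeta_reg a \<noteq> 0" "\<forall>\<^sub>F w in at a. zeta_reg w \<noteq> 0"
    "((\<lambda>w. (w - a) * (deriv zeta_reg w / zeta_reg w)) \<longlongrightarrow> of_nat m) (at a)"
proof (cases "zeta_reg constant_on {s. Re s > 0}")
  case True
  then obtain y where y: "\<And>s. Re s > 0 \<Longrightarrow> zeta_reg s = y"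
    by (auto simp: constant_on_def)
  have eq: "zeta_reg s = 1" if "Re s > 0" for s
    using y[OF that] y[of 1] by simp
  have near: "\<forall>\<^sub>F w in at a. w \<in> {s. Re s > 0} - {a}"
    using assms by (intro eventually_at_in_open open_halfspace_Re_gt) auto
  have "deriv zeta_reg w = 0" if "Re w > 0" for w
  proof -
    have "(zeta_reg has_field_derivative 0) (at w)"
      by (rule has_field_derivative_transform_within_open[of "\<lambda>_. 1" _ _ "{s. Re s > 0}"])
         (use that eq in \<open>auto simp: open_halfspace_Re_gt\<close>)
    then show ?thesis by (rule DERIV_imp_deriv)
  qed
  then have "\<forall>\<^sub>F w in at a. 0 = (w - a) * (deriv zeta_reg w / zeta_reg w)"
    using near by (auto elim: eventually_mono)
  then have "((\<lambda>w. (w - a) * (deriv zeta_reg w / zeta_reg w)) \<longlongrightarrow> 0) (at a)"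
    by (rule Lim_transform_eventually[rotated]) auto
  moreover have "\<forall>\<^sub>F w in at a. zeta_reg w \<noteq> 0"
    using near by eventually_elim (use eq in auto)
  ultimately show ?thesis using that[of 0] eq[OF assms] by simp
next
  case False
  have "connected {s. Re s > 0}"
    by (intro convex_connected convex_halfspace_Re_gt)
  moreover have "a \<in> {s. Re s > 0}" using assms by simp
  ultimately show ?thesis
    by (rule logderiv_tendsto_order[OF zeta_reg_holomorphic open_halfspace_Re_gt _ _ False]) (rule that)
qed

text \<open>By \<open>deriv_zeta_reg\<close> the logarithmic derivative agrees near a with a
  function continuous at a. Multiplied by w - a it tends to 0, so the order of
  \<open>zeta_reg\<close> at a is 0.\<close>

lemma zeta_reg_nonzero_Re_gt_1:
  assumes a: "Re a > 1"
  shows "zeta_reg a \<noteq> 0"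
proof -
  from a have "Re a > 0" by simp
  then obtain m :: nat where m: "m = 0 \<longleftrightarrow> zeta_reg a \<noteq> 0" "\<forall>\<^sub>F w in at a. zeta_reg w \<noteq> 0"
    "((\<lambda>w. (w - a) * (deriv zeta_reg w / zeta_reg w)) \<longlongrightarrow> of_nat m) (at a)"
    by (rule zeta_reg_order)
  have "\<forall>\<^sub>F w in at a. w \<in> {s. Re s > 1} - {a}"
    using a by (intro eventually_at_in_open open_halfspace_Re_gt) auto
  with m(2) have "\<forall>\<^sub>F w in at a. (w - a) * (deriv zeta_reg w / zeta_reg w)
        = (w - a) * (1 / (w - 1) - dirichlet mangoldt w)"
    by eventually_elim (simp add: deriv_zeta_reg)
  with m(3) have "((\<lambda>w. (w - a) * (1 / (w - 1) - dirichlet mangoldt w)) \<longlongrightarrow> of_nat m) (at a)"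
    by (rule Lim_transform_eventually)
  moreover have "((\<lambda>w. (w - a) * (1 / (w - 1) - dirichlet mangoldt w)) \<longlongrightarrow>
                    (a - a) * (1 / (a - 1) - dirichlet mangoldt a)) (at a)"
  proof -
    have "isCont (dirichlet mangoldt) a"
      using dirichlet_has_field_derivative[OF norm_mangoldt_le a] by (rule DERIV_isCont)
    moreover have "a \<noteq> 1" using a by auto
    ultimately show ?thesis by (intro tendsto_intros) (auto simp: isCont_def)
  qed
  ultimately have "of_nat m = (a - a) * (1 / (a - 1) - dirichlet mangoldt a)"
    by (intro tendsto_unique[OF trivial_limit_at])
  then have "m = 0" by simp
  then show ?thesis using m by simp
qed

text \<open>On the ray s = x + \<i> t the series is 1 / (s - 1) minus the logarithmic derivative of
  \<open>zeta_reg\<close>. After multiplication by x - 1 the first part tends to 1 or 0, according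
  to whether t = 0, and the second to the order.\<close>

lemma zeta_reg_order_line:
  obtains m :: nat where "m = 0 \<longleftrightarrow> zeta_reg (Complex 1 t) \<noteq> 0"
    "((\<lambda>x. (x - 1) * Re (dirichlet mangoldt (Complex x t))) \<longlongrightarrow> (if t = 0 then 1 else 0) - real m) (at_right 1)"
proof -
  define a where "a = Complex 1 t"
  have "Re a > 0" by (simp add: a_def)
  then obtain m :: nat where m: "m = 0 \<longleftrightarrow> zeta_reg a \<noteq> 0" "\<forall>\<^sub>F w in at a. zeta_reg w \<noteq> 0"
    "((\<lambda>w. (w - a) * (deriv zeta_reg w / zeta_reg w)) \<longlongrightarrow> of_nat m) (at a)"
    by (rule zeta_reg_order)
  have "((\<lambda>x. Complex x t) \<longlongrightarrow> a) (at_right 1)"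
    unfolding a_def by (intro tendsto_Complex tendsto_intros)
  moreover have "\<forall>\<^sub>F x in at_right 1. Complex x t \<noteq> a"
    using eventually_at_right_less[of "1::real"] by eventually_elim (simp add: a_def)
  ultimately have lim: "filterlim (\<lambda>x. Complex x t) (at a) (at_right 1)"
    by (simp add: filterlim_at)
  have "((\<lambda>x. (Complex x t - a) * (deriv zeta_reg (Complex x t) / zeta_reg (Complex x t)))
           \<longlongrightarrow> of_nat m) (at_right 1)"
    using m(3) lim by (rule filterlim_compose)
  moreover have "\<forall>\<^sub>F x in at_right 1. (Complex x t - a) * (deriv zeta_reg (Complex x t) / zeta_reg (Complex x t))
       = of_real (x - 1) * (1 / (Complex x t - 1) - dirichlet mangoldt (Complex x t))"
    using eventually_at_right_less[of "1::real"]
  proof eventually_elim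
    case (elim x)
    moreover have "Complex x t - a = of_real (x - 1)"
      by (simp add: a_def complex_eq_iff)
    ultimately show ?case
      using zeta_reg_nonzero_Re_gt_1[of "Complex x t"] by (simp add: deriv_zeta_reg)
  qed
  ultimately have 1: "((\<lambda>x. of_real (x - 1) * (1 / (Complex x t - 1) - dirichlet mangoldt (Complex x t)))
                         \<longlongrightarrow> of_nat m) (at_right 1)"
    by (rule Lim_transform_eventually)
  have 2: "((\<lambda>x. of_real (x - 1) * (1 / (Complex x t - 1))) \<longlongrightarrow> (if t = 0 then 1 else 0)) (at_right 1)"
  proof (cases "t = 0")
    case True
    have "\<forall>\<^sub>F x in at_right 1. 1 = of_real (x - 1) * (1 / (Complex x t - 1))"
      using eventually_at_right_less[of "1::real"]
    proof eventually_elim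
      case (elim x)
      have "Complex x t - 1 = of_real (x - 1)" using True by (simp add: complex_eq_iff)
      with elim show ?case by (simp del: of_real_diff)
    qed
    then have "((\<lambda>x. of_real (x - 1) * (1 / (Complex x t - 1))) \<longlongrightarrow> 1) (at_right 1)"
      by (rule Lim_transform_eventually[rotated]) auto
    then show ?thesis using True by simp
  next
    case False
    have "((\<lambda>x. of_real (x - 1) * (1 / (Complex x t - 1)))
             \<longlongrightarrow> of_real (1 - 1) * (1 / (Complex 1 t - 1))) (at_right 1)"
      using False by (intro tendsto_intros tendsto_Complex) (auto simp: complex_eq_iff)
    then show ?thesis using False by simp
  qed
  have "((\<lambda>x. of_real (x - 1) * (1 / (Complex x t - 1))
           - of_real (x - 1) * (1 / (Complex x t - 1) - dirichlet mangoldt (Complex x t)))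
           \<longlongrightarrow> (if t = 0 then 1 else 0) - of_nat m) (at_right 1)"
    by (intro tendsto_diff 1 2)
  then have "((\<lambda>x. of_real (x - 1) * dirichlet mangoldt (Complex x t))
                \<longlongrightarrow> (if t = 0 then 1 else 0) - of_nat m) (at_right 1)"
    by (simp add: right_diff_distrib)
  then have "((\<lambda>x. Re (of_real (x - 1) * dirichlet mangoldt (Complex x t)))
                \<longlongrightarrow> Re ((if t = 0 then 1 else 0) - of_nat m)) (at_right 1)"
    by (rule tendsto_Re)
  then show ?thesis by (intro that[of m]) (use m(1) in \<open>simp_all add: a_def if_distrib[of Re] cong: if_cong\<close>)
qed

text \<open>The inequality holds term by term: with c = cos (t ln n) the combination of cosines is 3
  + 4 c + (2 c^2 - 1) = 2 (1 + c)^2, and the von Mangoldt function is nonnegative.\<close>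

lemma three_four_one:
  assumes x: "x > 1"
  shows "3 * Re (dirichlet mangoldt (Complex x 0)) + 4 * Re (dirichlet mangoldt (Complex x t))
          + Re (dirichlet mangoldt (Complex x (2 * t))) \<ge> 0"
proof -
  have sums: "(\<lambda>n. mangoldt n * (real n powr (- x) * cos (u * ln (real n)))) sums Re (dirichlet mangoldt (Complex x u))" for u
  proof -
    have "(\<lambda>n. Re (mangoldt n * of_nat n powr (- Complex x u))) sums Re (dirichlet mangoldt (Complex x u))"
      using x by (intro sums_Re dirichlet_sums norm_mangoldt_le) auto
    moreover have "Re (mangoldt n * of_nat n powr (- Complex x u)) = mangoldt n * (real n powr (- x) * cos (u * ln (real n)))" for n
    proof (cases "n = 0")
      case False
      then have "Re (of_nat n powr (- Complex x u)) = real n powr (- x) * cos (u * ln (real n))"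
        by (simp add: powr_def Re_exp mult.commute)
      moreover have "Re (mangoldt n * w) = mangoldt n * Re w" for w
        by simp
      ultimately show ?thesis by simp
    qed simp
    ultimately show ?thesis by (simp only:)
  qed
  have "(\<lambda>n. 3 * (mangoldt n * (real n powr (- x) * cos (0 * ln (real n))))
          + 4 * (mangoldt n * (real n powr (- x) * cos (t * ln (real n))))
          + mangoldt n * (real n powr (- x) * cos (2 * t * ln (real n)))) sums
       (3 * Re (dirichlet mangoldt (Complex x 0)) + 4 * Re (dirichlet mangoldt (Complex x t))
          + Re (dirichlet mangoldt (Complex x (2 * t))))"
    by (intro sums_add sums_mult sums)
  moreover have "0 \<le> 3 * (mangoldt n * (real n powr (- x) * cos (0 * ln (real n))))
          + 4 * (mangoldt n * (real n powr (- x) * cos (t * ln (real n))))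
          + mangoldt n * (real n powr (- x) * cos (2 * t * ln (real n)))" for n
  proof -
    define c where "c = cos (t * ln (real n))"
    have cos: "cos (2 * t * ln (real n)) = 2 * c^2 - 1"
      unfolding c_def by (simp add: cos_double_cos mult.assoc)
    have "3 * (mangoldt n * (real n powr (- x) * cos (0 * ln (real n))))
          + 4 * (mangoldt n * (real n powr (- x) * cos (t * ln (real n))))
          + mangoldt n * (real n powr (- x) * cos (2 * t * ln (real n)))
        = mangoldt n * real n powr (- x) * (2 * (1 + c)^2)"
      unfolding cos c_def[symmetric] by (simp add: algebra_simps power2_eq_square)
    also have "\<dots> \<ge> 0" by (intro mult_nonneg_nonneg mangoldt_nonneg) auto
    finally show ?thesis .
  qed
  ultimately show ?thesis by (rule sums_le[OF _ sums_zero, rotated])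
qed

lemma zeta_reg_nonzero:
  assumes "Re s \<ge> 1"
  shows "zeta_reg s \<noteq> 0"
proof (cases "Re s = 1 \<and> Im s \<noteq> 0")
  case True
  define t where "t = Im s"
  have s: "s = Complex 1 t" and t: "t \<noteq> 0" using True by (auto simp: t_def complex_eq_iff)
  let ?R = "\<lambda>t x. Re (dirichlet mangoldt (Complex x t))"
  obtain m0 :: nat where m0: "m0 = 0 \<longleftrightarrow> zeta_reg (Complex 1 0) \<noteq> 0"
    "((\<lambda>x. (x - 1) * ?R 0 x) \<longlongrightarrow> (if (0::real) = 0 then 1 else 0) - real m0) (at_right 1)"
    by (rule zeta_reg_order_line[of 0])
  obtain m1 :: nat where m1: "m1 = 0 \<longleftrightarrow> zeta_reg (Complex 1 t) \<noteq> 0"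
    "((\<lambda>x. (x - 1) * ?R t x) \<longlongrightarrow> (if t = 0 then 1 else 0) - real m1) (at_right 1)"
    by (rule zeta_reg_order_line[of t])
  obtain m2 :: nat where m2: "m2 = 0 \<longleftrightarrow> zeta_reg (Complex 1 (2 * t)) \<noteq> 0"
    "((\<lambda>x. (x - 1) * ?R (2 * t) x) \<longlongrightarrow> (if 2 * t = 0 then 1 else 0) - real m2) (at_right 1)"
    by (rule zeta_reg_order_line[of "2 * t"])
  have "Complex 1 0 = 1" by (simp add: complex_eq_iff)
  then have [simp]: "m0 = 0" using m0(1) by simp
  have "((\<lambda>x. 3 * ((x - 1) * ?R 0 x) + 4 * ((x - 1) * ?R t x) + (x - 1) * ?R (2 * t) x)
           \<longlongrightarrow> 3 * 1 + 4 * (- real m1) + (- real m2)) (at_right 1)"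
    using m0(2) m1(2) m2(2) t by (intro tendsto_intros) auto
  moreover have "\<forall>\<^sub>F x in at_right 1. 3 * ((x - 1) * ?R 0 x) + 4 * ((x - 1) * ?R t x) + (x - 1) * ?R (2 * t) x \<ge> 0"
    using eventually_at_right_less[of "1::real"]
  proof eventually_elim
    case (elim x)
    have "0 \<le> (x - 1) * (3 * ?R 0 x + 4 * ?R t x + ?R (2 * t) x)"
      using three_four_one[of x t] elim by simp
    then show ?case by (simp add: algebra_simps)
  qed
  ultimately have "3 * 1 + 4 * (- real m1) + (- real m2) \<ge> 0"
    by (intro tendsto_lowerbound) auto
  \<comment> \<open>The orders are natural numbers, so m1 \<ge> 1 would make the left-hand side at
    most -1.\<close>
  then have "m1 = 0" by linarith
  then show ?thesis using m1 s by simp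
next
  case False
  then consider "s = 1" | "Re s > 1" using assms by (force simp: complex_eq_iff)
  then show ?thesis by cases (auto simp: zeta_reg_nonzero_Re_gt_1)
qed

section \<open>The Chebyshev function\<close>

definition psi :: "nat \<Rightarrow> real" where
  "psi n = (\<Sum>k\<le>n. mangoldt k)"

lemma psi_0 [simp]: "psi 0 = 0" and psi_Suc: "psi (Suc n) = psi n + mangoldt (Suc n)"
  by (simp_all add: psi_def)

lemma psi_nonneg: "psi n \<ge> 0"
  unfolding psi_def by (intro sum_nonneg mangoldt_nonneg)

lemma psi_mono: "m \<le> n \<Longrightarrow> psi m \<le> psi n"
  unfolding psi_def by (intro sum_mono2 mangoldt_nonneg) auto

text \<open>Sum ln k, written as a sum over the divisors of k, over k \<le> n: each d divides n div
  d of these k. The free upper limit \<open>M\<close> lets the formulas for n and 2 n be subtracted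
  term by term.\<close>

lemma ln_fact_eq_sum_mangoldt:
  assumes "n \<le> M"
  shows "ln (fact n) = (\<Sum>d=1..M. mangoldt d * real (n div d))"
  using assms
proof (induction n)
  case 0
  show ?case by simp
next
  case (Suc n)
  have "mangoldt d * real (Suc n div d) = mangoldt d * real (n div d) + (if d dvd Suc n then mangoldt d else 0)" for d
    by (auto simp: div_Suc dvd_eq_mod_eq_0 algebra_simps)
  then have "(\<Sum>d=1..M. mangoldt d * real (Suc n div d)) =
      (\<Sum>d=1..M. mangoldt d * real (n div d)) + (\<Sum>d=1..M. if d dvd Suc n then mangoldt d else 0)"
    by (simp only: sum.distrib)
  also have "(\<Sum>d=1..M. if d dvd Suc n then mangoldt d else 0) = (\<Sum>d | d dvd Suc n. mangoldt d :: real)"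
  proof -
    have "d \<in> {1..M}" if "d dvd Suc n" for d
      using that dvd_imp_le[OF that] Suc.prems by (cases d) auto
    then show ?thesis by (intro sum.mono_neutral_cong_right) auto
  qed
  also have "\<dots> = ln (real (Suc n))"
    using mangoldt_sum[of "Suc n", where ?'a = real] by simp
  also have "(\<Sum>d=1..M. mangoldt d * real (n div d)) = ln (fact n)"
    using Suc by simp
  finally show ?case by (simp add: ln_mult add.commute del: of_nat_Suc)
qed

text \<open>Chebyshev's argument: the integer part of 2 n / d minus twice that of n / d is
  nonnegative, and it is 1 for n < d \<le> 2 n. Weighted by the von Mangoldt function these
  differences add up to the logarithm of the central binomial coefficient, which is at most 2 n ln
  2.\<close>

lemma psi_double_le: "psi (2 * n) - psi n \<le> 2 * real n"
proof -
  have "psi (2 * n) - psi n = (\<Sum>d\<in>{n<..2 * n}. mangoldt d)"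
  proof -
    have "{..2 * n} = {..n} \<union> {n<..2 * n}" by auto
    then have "psi (2 * n) = psi n + (\<Sum>d\<in>{n<..2 * n}. mangoldt d)"
      unfolding psi_def by (simp only:) (rule sum.union_disjoint, auto)
    then show ?thesis by simp
  qed
  also have "\<dots> = (\<Sum>d\<in>{n<..2 * n}. mangoldt d * (real (2 * n div d) - 2 * real (n div d)))"
  proof (intro sum.cong refl)
    fix d assume d: "d \<in> {n<..2 * n}"
    then have "2 * n div d = 1" by (intro div_nat_eqI) auto
    then show "mangoldt d = mangoldt d * (real (2 * n div d) - 2 * real (n div d))"
      using d by simp
  qed
  also have "\<dots> \<le> (\<Sum>d=1..2 * n. mangoldt d * (real (2 * n div d) - 2 * real (n div d)))"
  proof (intro sum_mono2)
    fix d
    have "2 * (n div d) \<le> 2 * n div d" by (cases "d = 0") (auto simp: less_eq_div_iff_mult_less_eq)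
    then have "2 * real (n div d) \<le> real (2 * n div d)" by linarith
    then show "0 \<le> mangoldt d * (real (2 * n div d) - 2 * real (n div d))"
      by (intro mult_nonneg_nonneg mangoldt_nonneg) auto
  qed auto
  also have "\<dots> = ln (fact (2 * n)) - 2 * ln (fact n)"
    using ln_fact_eq_sum_mangoldt[of "2 * n" "2 * n"] ln_fact_eq_sum_mangoldt[of n "2 * n"]
    by (simp add: right_diff_distrib sum_subtractf sum_distrib_left mult.left_commute)
  also have "\<dots> = ln (real ((2 * n) choose n))"
    by (simp add: binomial_fact ln_div ln_mult)
  also have "\<dots> \<le> ln (2 ^ (2 * n))"
  proof -
    have "(2 * n) choose n \<le> 2 ^ (2 * n)"
      by (metis binomial_le_pow2)
    then have "real ((2 * n) choose n) \<le> 2 ^ (2 * n)"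
      by (metis of_nat_le_iff of_nat_numeral of_nat_power)
    then show ?thesis by (subst ln_le_cancel_iff) auto
  qed
  also have "\<dots> = 2 * real n * ln 2" by (simp add: ln_realpow)
  also have "\<dots> \<le> 2 * real n * 1" using ln_le_minus_one[of 2] by (intro mult_left_mono) auto
  finally show ?thesis by simp
qed

lemma psi_le: "psi n \<le> 4 * real n"
proof (induction n rule: less_induct)
  case (less n)
  consider "n \<le> 1" | "n > 1" by linarith
  then show ?case
  proof cases
    case 1
    then have "n = 0 \<or> n = Suc 0" by auto
    then show ?thesis by (auto simp: psi_Suc)
  next
    case 2
    \<comment> \<open>Half of n, rounded up so that n \<le> 2 m. The final 6 m \<le> 4 n follows by
      adding twice m \<le> n - 1 and twice 2 m \<le> n + 1.\<close>
    define m where "m = (n + 1) div 2"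
    have m: "m < n" "n \<le> 2 * m" "2 * m \<le> n + 1" using 2 by (auto simp: m_def)
    have "psi n \<le> psi (2 * m)" using m by (intro psi_mono)
    also have "\<dots> \<le> psi m + 2 * real m" using psi_double_le[of m] by simp
    also have "\<dots> \<le> 6 * real m" using less.IH[OF m(1)] by simp
    also have "\<dots> \<le> 4 * real n" using m 2 by linarith
    finally show ?thesis .
  qed
qed

lemma abs_psi_minus_le: "\<bar>psi n - real n\<bar> \<le> 4 * real n"
  using psi_le[of n] psi_nonneg[of n] by linarith

section \<open>From the convergent series to the asymptotics\<close>

lemma psi_asymptotics_of_summable:
  fixes f :: "nat \<Rightarrow> real"
  assumes mono: "mono f" and summable: "summable (\<lambda>n. (f n - real n) / (real n * (real n + 1)))"
  shows "(\<lambda>n. f n / real n) \<longlonglongrightarrow> 1"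
proof (rule tendstoI)
  let ?g = "\<lambda>n. (f n - real n) / (real n * (real n + 1))"
  fix e :: real assume e: "e > 0"
  define h where "h = min e 1"
  have h: "h > 0" "h \<le> 1" "h \<le> e" using e by (auto simp: h_def)
  \<comment> \<open>The threshold is what a deviation would produce: at least h n / 2 terms, each at
    least (h n / 2) / (2 n)^2 = h / (8 n) in absolute value.\<close>
  from summable obtain N where N: "\<And>m n. m \<ge> N \<Longrightarrow> norm (sum ?g {m..<n}) < h^2 / 16"
    using h unfolding summable_Cauchy by (metis zero_less_divide_iff zero_less_numeral zero_less_power)
  \<comment> \<open>As M \<le> n / 2, this bound on n keeps the window from n - M to n beyond N as
    well.\<close>
  have "dist (f n / real n) 1 < e" if n: "n \<ge> 2 * N + 2" for n
  proof -
    \<comment> \<open>Moving k by at most h n / 2 away from n uses up at most half of the assumed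
      deviation h n, so h n / 2 of it remains.\<close>
    define M where "M = nat \<lfloor>h * real n / 2\<rfloor>"
    have M: "real M \<le> h * real n / 2" "h * real n / 2 \<le> real M + 1"
      using h by (simp_all add: M_def) linarith+
    have hn: "0 \<le> h * real n" using h by simp
    have "h * real n \<le> 1 * real n" using h by (intro mult_right_mono) auto
    then have Mn: "2 * real M \<le> real n" using M by linarith
    have card: "h^2 / 16 \<le> real (M + 1) * (h / (8 * real n))"
    proof -
      have "h^2 / 16 = (h * real n / 2) * (h / (8 * real n))"
        using n by (simp add: field_simps power2_eq_square)
      also have "\<dots> \<le> real (M + 1) * (h / (8 * real n))"
        using M h by (intro mult_right_mono) auto
      finally show ?thesis .
    qed
    have eq: "(h * real n / 2) / (2 * real n * (2 * real n)) = h / (8 * real n)"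
      using n by (simp add: field_simps)
    have upper: "f n < (1 + h) * real n"
    proof (rule ccontr)
      assume *: "\<not> f n < (1 + h) * real n"
      have "h / (8 * real n) \<le> ?g k" if k: "k \<in> {n..<n + (M + 1)}" for k
      proof -
        have k': "real k \<le> real n + real M" "n \<le> k" using k by auto
        have "f n \<le> f k" using mono k' by (auto dest: monoD)
        then have *: "h * real n / 2 \<le> f k - real k" using * k' M by (simp add: algebra_simps)
        have "real k \<le> 2 * real n" "real k + 1 \<le> 2 * real n" using k' Mn n by linarith+
        then have "real k * (real k + 1) \<le> 2 * real n * (2 * real n)"
          by (intro mult_mono) auto
        then have "(h * real n / 2) / (2 * real n * (2 * real n)) \<le> ?g k"
          using * n k' hn by (intro frac_le) auto
        then show ?thesis unfolding eq .
      qed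
      then have "of_nat (card {n..<n + (M + 1)}) * (h / (8 * real n)) \<le> sum ?g {n..<n + (M + 1)}"
        by (rule sum_bounded_below)
      also have "card {n..<n + (M + 1)} = M + 1" by simp
      finally have "h^2 / 16 \<le> sum ?g {n..<n + (M + 1)}" using card by (rule order_trans[rotated])
      moreover have "norm (sum ?g {n..<n + (M + 1)}) < h^2 / 16" using n by (intro N) auto
      ultimately show False unfolding real_norm_def by linarith
    qed
    \<comment> \<open>The mirror image uses a window below n, because monotonicity carries an upper
      bound on f n to smaller arguments.\<close>
    have lower: "f n > (1 - h) * real n"
    proof (rule ccontr)
      assume *: "\<not> f n > (1 - h) * real n"
      have "?g k \<le> - (h / (8 * real n))" if k: "k \<in> {n - M..<n + 1}" for k
      proof -
        have k': "real k \<ge> real n - real M" "k \<le> n" using k by auto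
        have kpos: "real k > 0" using k' Mn n by linarith
        have "f k \<le> f n" using mono k' by (auto dest: monoD)
        then have *: "h * real n / 2 \<le> real k - f k" using * k' M by (simp add: algebra_simps)
        have "real k \<le> 2 * real n" "real k + 1 \<le> 2 * real n" using k' n by linarith+
        then have "real k * (real k + 1) \<le> 2 * real n * (2 * real n)"
          by (intro mult_mono) auto
        then have "(h * real n / 2) / (2 * real n * (2 * real n)) \<le> (real k - f k) / (real k * (real k + 1))"
          using * n kpos hn by (intro frac_le) auto
        also have "\<dots> = - ?g k" by (simp only: minus_divide_left minus_diff_eq)
        finally show ?thesis unfolding eq by simp
      qed
      then have "sum ?g {n - M..<n + 1} \<le> of_nat (card {n - M..<n + 1}) * (- (h / (8 * real n)))"
        by (rule sum_bounded_above)
      also have "card {n - M..<n + 1} = M + 1" using Mn by simp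
      finally have "sum ?g {n - M..<n + 1} \<le> - (h^2 / 16)" using card by linarith
      moreover have "norm (sum ?g {n - M..<n + 1}) < h^2 / 16" using n Mn by (intro N) linarith
      ultimately show False unfolding real_norm_def by linarith
    qed
    have "n > 0" using n by simp
    then have "\<bar>f n / real n - 1\<bar> < h"
      using upper lower by (simp add: abs_less_iff field_simps)
    then show ?thesis using h by (simp add: dist_real_def)
  qed
  then show "\<forall>\<^sub>F n in sequentially. dist (f n / real n) 1 < e"
    by (auto intro: eventually_sequentiallyI[of "2 * N + 2"])
qed

section \<open>Applying the Tauberian theorem to psi\<close>

text \<open>This is \<open>\<integral>\<^sub>m\<^sup>m\<^sup>+\<^sup>1 t\<^sup>-\<^sup>2\<^sup>-\<^sup>z dt\<close>, with the removable singularity at \<open>z = -1\<close> filled in.\<close>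

definition psi_kernel :: "nat \<Rightarrow> complex \<Rightarrow> complex" where
  "psi_kernel m = (let g = (\<lambda>z. of_nat m powr (- 1 - z) - of_nat (Suc m) powr (- 1 - z))
                   in (\<lambda>z. if z = - 1 then deriv g (- 1) else (g z - g (- 1)) / (z - (- 1))))"

lemma psi_kernel_holomorphic:
  assumes "m > 0"
  shows "psi_kernel m holomorphic_on UNIV"
  unfolding psi_kernel_def Let_def
  using assms by (intro holomorphic_on_divided_difference holomorphic_intros) auto

lemma psi_kernel_eq:
  assumes "m > 0" "z \<noteq> - 1"
  shows "psi_kernel m z = (of_nat m powr (- (1 + z)) - of_nat (Suc m) powr (- (1 + z))) / (1 + z)"
  using assms by (simp add: psi_kernel_def Let_def add.commute del: of_nat_Suc)

text \<open>In the integral of t^(-2 - z) one factor 1 / t is bounded by 1 / m, and the remaining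
  t^(-1 - Re z) is integrated exactly by \<open>?\<phi>\<close>. The factor m on the left pays for
  \<open>abs_psi_minus_le\<close>; the right-hand side has the telescoping shape of the Tauberian
  hypothesis.\<close>

lemma norm_psi_kernel_le:
  assumes m: "m > 0" and z: "z \<noteq> - 1" and x: "Re z \<noteq> 0"
  shows "real m * norm (psi_kernel m z) \<le> (real m powr (- Re z) - real (Suc m) powr (- Re z)) / Re z"
proof -
  define c where "c = norm (1 + z) / real m"
  have z1: "1 + z \<noteq> 0" using z by (metis add.commute add_eq_0_iff)
  then have c: "c > 0" using m by (simp add: c_def)
  let ?f = "\<lambda>t. of_real t powr (- (1 + z)) :: complex"
  let ?\<phi> = "\<lambda>t. - (c * t powr (- Re z) / Re z)"
  have "norm (?f (real m + 1) - ?f (real m)) \<le> ?\<phi> (real m + 1) - ?\<phi> (real m)"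
  proof (rule differentiable_bound_general)
    show "(?f has_vector_derivative (- (1 + z)) * of_real t powr (- (1 + z) - 1)) (at t)" if "real m < t" for t
      using that m by (intro has_vector_derivative_of_real_powr) auto
    show "(?\<phi> has_vector_derivative c * t powr (- Re z - 1)) (at t)" if "real m < t" for t
      using that m x
      by (auto intro!: derivative_eq_intros simp: powr_diff simp flip: has_real_derivative_iff_has_vector_derivative)
    show "norm (- (1 + z) * of_real t powr (- (1 + z) - 1)) \<le> c * t powr (- Re z - 1)" if t: "real m < t" for t
    proof -
      have "norm (- (1 + z) * of_real t powr (- (1 + z) - 1)) = norm (1 + z) * t powr (- 1 - Re z - 1)"
        using t m by (simp add: norm_mult norm_powr_real_powr norm_minus_commute minus_diff_commute
                       del: minus_add_distrib)
      also have "\<dots> = norm (1 + z) * (t powr (- Re z - 1) / t)"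
        using t m by (simp add: powr_diff powr_minus field_simps power2_eq_square)
      also have "\<dots> \<le> norm (1 + z) * (t powr (- Re z - 1) / real m)"
        using t m by (intro mult_left_mono divide_left_mono) auto
      finally show ?thesis by (simp add: c_def)
    qed
    show "continuous_on {real m..real m + 1} ?f"
      using m by (auto intro!: continuous_intros)
    show "continuous_on {real m..real m + 1} ?\<phi>"
      using m x by (auto intro!: continuous_intros)
  qed auto
  also have "\<dots> = c * ((real m powr (- Re z) - real (Suc m) powr (- Re z)) / Re z)"
    by (simp add: algebra_simps diff_divide_distrib)
  also have "norm (?f (real m + 1) - ?f (real m)) = norm (psi_kernel m z) * norm (1 + z)"
    using z1 by (subst norm_minus_commute) (simp add: psi_kernel_eq[OF m z] norm_divide add.commute)
  finally have "norm (1 + z) * norm (psi_kernel m z)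
      \<le> norm (1 + z) * ((real m powr (- Re z) - real (Suc m) powr (- Re z)) / Re z / real m)"
    by (simp add: c_def mult.commute)
  then have "norm (psi_kernel m z) \<le> (real m powr (- Re z) - real (Suc m) powr (- Re z)) / Re z / real m"
    using z1 by (subst (asm) mult_le_cancel_left_pos) auto
  then show ?thesis
    using m by (subst (asm) pos_le_divide_eq) (simp_all add: mult.commute del: of_nat_Suc)
qed

text \<open>Summation by parts: the coefficients of the difference of the two series have partial
  sums psi N - N, and the boundary term is O(N^(1 - Re s)), hence vanishes in the limit.\<close>

lemma sums_psi_minus:
  assumes s: "Re s > 1"
  shows "(\<lambda>n. of_real (psi (Suc n) - real (Suc n)) * (of_nat (Suc n) powr (- s) - of_nat (Suc (Suc n)) powr (- s)))
           sums (dirichlet mangoldt s - dirichlet (\<lambda>_. 1) s)"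
proof -
  define f where "f = (\<lambda>n. (mangoldt n - 1) * of_nat n powr (- s) :: complex)"
  have "(\<lambda>n. mangoldt n * of_nat n powr (- s) - 1 * of_nat n powr (- s)) sums (dirichlet mangoldt s - dirichlet (\<lambda>_. 1) s)"
    using s by (intro sums_diff dirichlet_sums norm_mangoldt_le) auto
  then have "f sums (dirichlet mangoldt s - dirichlet (\<lambda>_. 1) s)"
    by (simp add: f_def algebra_simps)
  then have "(\<lambda>n. f (Suc n)) sums (dirichlet mangoldt s - dirichlet (\<lambda>_. 1) s)"
    by (subst sums_Suc_iff) (simp add: f_def)
  moreover have "(\<lambda>N. of_real (psi N - real N) * of_nat (Suc N) powr (- s)) \<longlonglongrightarrow> 0"
  proof (rule Lim_null_comparison)
    show "\<forall>\<^sub>F N in sequentially. norm (of_real (psi N - real N) * of_nat (Suc N) powr (- s) :: complex)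
             \<le> 4 * real (Suc N) powr (1 - Re s)"
    proof (intro always_eventually allI)
      fix N
      have "norm (of_real (psi N - real N) * of_nat (Suc N) powr (- s) :: complex)
           = \<bar>psi N - real N\<bar> * real (Suc N) powr (- Re s)"
        by (simp only: norm_mult norm_of_real norm_of_nat_powr uminus_complex.sel)
      also have "\<dots> \<le> (4 * real (Suc N)) * real (Suc N) powr (- Re s)"
        using abs_psi_minus_le[of N] by (intro mult_right_mono) auto
      also have "\<dots> = 4 * real (Suc N) powr (1 - Re s)"
        by (simp add: powr_diff powr_minus field_simps del: of_nat_Suc)
      finally show "norm (of_real (psi N - real N) * of_nat (Suc N) powr (- s) :: complex)
             \<le> 4 * real (Suc N) powr (1 - Re s)" .
    qed
    show "(\<lambda>N. 4 * real (Suc N) powr (1 - Re s)) \<longlonglongrightarrow> 0"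
      using s by real_asymp
  qed
  ultimately have "(\<lambda>N. (\<Sum>n<N. f (Suc n)) - of_real (psi N - real N) * of_nat (Suc N) powr (- s)) 
       \<longlonglongrightarrow> (dirichlet mangoldt s - dirichlet (\<lambda>_. 1) s) - 0"
    by (intro tendsto_diff) (auto simp: sums_def)
  moreover have "(\<Sum>n<N. of_real (psi (Suc n) - real (Suc n)) * (of_nat (Suc n) powr (- s) - of_nat (Suc (Suc n)) powr (- s)))
     = (\<Sum>n<N. f (Suc n)) - of_real (psi N - real N) * of_nat (Suc N) powr (- s)" for N
    by (induction N) (simp_all add: f_def psi_Suc algebra_simps)
  ultimately show ?thesis by (simp add: sums_def)
qed

lemma summable_psi_minus: "summable (\<lambda>n. (psi n - real n) / (real n * (real n + 1)))"
proof -
  \<comment> \<open>As \<open>zeta_reg 1 = 1\<close>, \<open>Q\<close> continues zeta(s) - 1 / (s -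
    1) to Re s > 0. In \<open>F\<close> its pole part cancels that of the logarithmic derivative,
    which leaves (L s - zeta(s)) / s at s = 1 + z.\<close>
  define Q where "Q = (\<lambda>s. if s = 1 then deriv zeta_reg 1 else (zeta_reg s - zeta_reg 1) / (s - 1))"
  define F where "F = (\<lambda>z. (- (deriv zeta_reg (1 + z) / zeta_reg (1 + z)) - Q (1 + z)) / (1 + z))"
  define H where "H = {s. Re s > 0}"
  define U where "U = (\<lambda>z. 1 + z) -` {s \<in> H. zeta_reg s \<noteq> 0}"
  define k where "k = (\<lambda>n z. of_real (psi (Suc n) - real (Suc n)) * psi_kernel (Suc n) z)"
  have H: "open H" unfolding H_def by (rule open_halfspace_Re_gt)
  have hol: "zeta_reg holomorphic_on H" "deriv zeta_reg holomorphic_on H" "Q holomorphic_on H"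
    using zeta_reg_holomorphic H holomorphic_deriv holomorphic_on_divided_difference[of zeta_reg H 1]
    by (auto simp: H_def Q_def)
  have "open {s \<in> H. zeta_reg s \<noteq> 0}"
    using H holomorphic_on_imp_continuous_on[OF hol(1)] continuous_open_preimage[of H zeta_reg "- {0}"]
    by (simp add: vimage_def Int_def open_Compl)
  then have U: "open U"
    unfolding U_def by (intro open_vimage) (auto intro!: continuous_intros)
  have "F holomorphic_on U"
  proof -
    have shift: "(\<lambda>z. g (1 + z)) holomorphic_on U" if "g holomorphic_on H" for g
    proof -
      have "(\<lambda>z. 1 + z) ` U \<subseteq> H" by (auto simp: U_def)
      moreover have "(\<lambda>z. 1 + z) holomorphic_on U" by (intro holomorphic_intros)
      ultimately show ?thesis
        using holomorphic_on_compose_gen[OF _ that, of "\<lambda>z. 1 + z" U] by (simp add: o_def)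
    qed
    have "1 + z \<noteq> 0" if "z \<in> U" for z using that by (auto simp: U_def H_def complex_eq_iff)
    then show ?thesis
      unfolding F_def using hol
      by (intro holomorphic_on_divide holomorphic_on_diff holomorphic_on_minus shift holomorphic_intros)
         (use H in \<open>auto simp: U_def\<close>)
  qed
  have "(\<lambda>n. k n 0) sums F 0"
  \<comment> \<open>With this \<open>l\<close>, exp (- l n Re z) is the power (n + 1)^(- Re z); the
    constant 4 is Chebyshev's bound from \<open>abs_psi_minus_le\<close>.\<close>
  proof (rule Newman_Tauberian[where l = "\<lambda>n. ln (real (Suc n))" and C = 4 and U = U])
    show "k n holomorphic_on UNIV" for n
      unfolding k_def by (intro holomorphic_intros psi_kernel_holomorphic) auto
    show "filterlim (\<lambda>n. ln (real (Suc n))) at_top sequentially"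
      by real_asymp
    show "{z. Re z \<ge> 0} \<subseteq> U"
      using zeta_reg_nonzero by (auto simp: U_def H_def)
    show "norm (k n z) \<le> 4 * ((exp (- (ln (real (Suc n)) * Re z)) - exp (- (ln (real (Suc (Suc n))) * Re z))) / Re z)"
      if "Re z \<noteq> 0" "norm z > 1" for n z
    proof -
      have z: "z \<noteq> - 1" using that by auto
      have "norm (k n z) \<le> (4 * real (Suc n)) * norm (psi_kernel (Suc n) z)"
        unfolding k_def norm_mult norm_of_real by (intro mult_right_mono abs_psi_minus_le) auto
      also have "\<dots> \<le> 4 * ((real (Suc n) powr (- Re z) - real (Suc (Suc n)) powr (- Re z)) / Re z)"
        unfolding mult.assoc using z that by (intro mult_left_mono norm_psi_kernel_le) auto
      finally show ?thesis by (simp add: powr_def mult.commute del: of_nat_Suc)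
    qed
    show "(\<lambda>n. k n z) sums F z" if z: "Re z > 0" for z
    proof -
      have s: "Re (1 + z) > 1" "1 + z \<noteq> 0" "z \<noteq> - 1" "1 + z \<noteq> 1" using z by (auto simp: complex_eq_iff)
      have "(\<lambda>n. k n z) sums ((dirichlet mangoldt (1 + z) - dirichlet (\<lambda>_. 1) (1 + z)) / (1 + z))"
        using sums_divide[OF sums_psi_minus[OF s(1)], of "1 + z"] s
        by (simp add: k_def psi_kernel_eq del: of_nat_Suc of_real_diff)
      also have "(dirichlet mangoldt (1 + z) - dirichlet (\<lambda>_. 1) (1 + z)) / (1 + z) = F z"
      proof -
        have "zeta_reg (1 + z) \<noteq> 0" using s by (intro zeta_reg_nonzero) auto
        then have "- (deriv zeta_reg (1 + z) / zeta_reg (1 + z)) = dirichlet mangoldt (1 + z) - 1 / z"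
          using deriv_zeta_reg[OF s(1)] by simp
        moreover have "Q (1 + z) = dirichlet (\<lambda>_. 1) (1 + z) - 1 / z"
          using zeta_reg_eq_dirichlet[OF s(1)] s by (simp add: Q_def diff_divide_distrib)
        ultimately show ?thesis by (simp add: F_def)
      qed
      finally show ?thesis .
    qed
  qed (use U \<open>F holomorphic_on U\<close> in auto)
  then have "summable (\<lambda>n. Re (k n 0))"
    by (intro summable_Re sums_summable)
  moreover have "Re (k n 0) = (psi (Suc n) - real (Suc n)) / (real (Suc n) * (real (Suc n) + 1))" for n
  proof -
    have "psi_kernel (Suc n) 0 = of_real (1 / real (Suc n) - 1 / real (Suc (Suc n)))"
      by (simp add: psi_kernel_eq powr_minus inverse_eq_divide del: of_nat_Suc)
    also have "1 / real (Suc n) - 1 / real (Suc (Suc n)) = 1 / (real (Suc n) * (real (Suc n) + 1))"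
      by (simp add: field_simps)
    finally show ?thesis by (simp add: k_def del: of_nat_Suc)
  qed
  ultimately show ?thesis by (subst summable_Suc_iff [symmetric]) simp
qed

theorem psi_asymptotics: "(\<lambda>n. psi n / real n) \<longlonglongrightarrow> 1"
  using psi_mono summable_psi_minus by (intro psi_asymptotics_of_summable) (auto simp: mono_def)

section \<open>The prime-counting function\<close>

lemma finite_primes_le_real: "finite {p :: nat. prime p \<and> real p \<le> x}"
  by (rule finite_subset[of _ "{..nat \<lfloor>x\<rfloor>}"]) (auto simp: le_nat_floor)

text \<open>The elements counted are powers p^j with j \<ge> 1. Their number is at most the largest
  such exponent, and that power of p is still at most n.\<close>

lemma card_prime_powers_mult_ln_le:
  assumes p: "prime p" and n: "n > 0"
  shows "real (card {k. k \<le> n \<and> primepow k \<and> aprimedivisor k = p}) * ln (real p) \<le> ln (real n)"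
proof -
  let ?A = "{k. k \<le> n \<and> primepow k \<and> aprimedivisor k = p}"
  define J where "J = {j. j > 0 \<and> p ^ j \<le> n}"
  have p2: "p \<ge> 2" using p by (rule prime_ge_2_nat)
  have J_le: "j \<le> n" if "j \<in> J" for j
  proof -
    have "j < 2 ^ j" by (rule less_exp)
    also have "(2::nat) ^ j \<le> p ^ j" using p2 by (rule power_mono) simp
    also have "\<dots> \<le> n" using that by (simp add: J_def)
    finally show ?thesis by simp
  qed
  then have fin: "finite J" by (intro finite_subset[of J "{..n}"]) auto
  have "?A \<subseteq> (\<lambda>j. p ^ j) ` J"
  proof
    fix k assume k: "k \<in> ?A"
    then obtain q j where qj: "prime q" "j > 0" "k = q ^ j"
      by (auto simp: primepow_def)
    then have "q = p" using k by (simp add: aprimedivisor_prime_power)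
    then show "k \<in> (\<lambda>j. p ^ j) ` J" using k qj by (auto simp: J_def)
  qed
  then have card_le: "card ?A \<le> card J"
    using fin by (meson card_image_le card_mono finite_imageI order_trans)
  show ?thesis
  proof (cases "J = {}")
    case True
    then have "card ?A = 0" using card_le by simp
    then show ?thesis using n by (simp only:) simp
  next
    case False
    define j where "j = Max J"
    have "j \<in> J" using False fin by (simp add: j_def)
    have "J \<subseteq> {1..j}" using fin by (auto simp: j_def J_def Suc_le_eq)
    then have "card J \<le> j" using card_mono[of "{1..j}" J] by simp
    then have "real (card ?A) * ln (real p) \<le> real j * ln (real p)"
      using card_le p2 by (intro mult_right_mono) auto
    also have "\<dots> = ln (real (p ^ j))" using p2 by (simp add: ln_realpow)
    also have "\<dots> \<le> ln (real n)"
      using \<open>j \<in> J\<close> n p2 by (subst ln_le_cancel_iff) (auto simp: J_def simp del: of_nat_power)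
    finally show ?thesis .
  qed
qed

text \<open>Group the prime powers up to n by their base: each prime contributes at most ln
  n.\<close>

lemma psi_le_prime_pi_mult_ln:
  assumes n: "n > 0"
  shows "psi n \<le> real (prime_pi (real n)) * ln (real n)"
proof -
  let ?P = "{p. prime p \<and> real p \<le> real n}"
  let ?S = "{k. k \<le> n \<and> primepow k}"
  have "psi n = (\<Sum>k\<in>?S. mangoldt k)"
    unfolding psi_def by (intro sum.mono_neutral_right) (auto simp: mangoldt_def)
  also have "\<dots> = (\<Sum>k\<in>?S. ln (real (aprimedivisor k)))"
    by (intro sum.cong) (auto simp: mangoldt_def)
  also have "\<dots> = (\<Sum>p\<in>?P. \<Sum>k\<in>{k\<in>?S. aprimedivisor k = p}. ln (real (aprimedivisor k)))"
  proof (intro sum.group [symmetric])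
    show "aprimedivisor ` ?S \<subseteq> ?P"
    proof safe
      fix k :: nat assume k: "k \<le> n" "primepow k"
      have "k > 1" using k(2) by (rule primepow_gt_Suc_0[unfolded One_nat_def[symmetric]])
      then show "prime (aprimedivisor k)" by (intro prime_aprimedivisor') auto
      have "aprimedivisor k \<le> k" using \<open>k > 1\<close> by (intro dvd_imp_le aprimedivisor_dvd') auto
      then show "real (aprimedivisor k) \<le> real n" using k by simp
    qed
  qed (auto simp: finite_primes_le_real)
  also have "\<dots> = (\<Sum>p\<in>?P. real (card {k. k \<le> n \<and> primepow k \<and> aprimedivisor k = p}) * ln (real p))"
    by (intro sum.cong) (auto simp: conj_assoc)
  also have "\<dots> \<le> (\<Sum>p\<in>?P. ln (real n))"
    using n by (intro sum_mono card_prime_powers_mult_ln_le) auto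
  finally show ?thesis by (simp add: prime_pi_def)
qed

text \<open>At most y primes lie up to \<open>y\<close>, and each prime above \<open>y\<close>
  contributes more than ln y to psi. The parameter \<open>y\<close> is left free to be optimised
  later.\<close>

lemma prime_pi_le:
  assumes y: "1 < y"
  shows "real (prime_pi x) \<le> y + psi (nat \<lfloor>x\<rfloor>) / ln y"
proof -
  let ?P = "{p. prime p \<and> real p \<le> x}"
  let ?S = "{p. prime p \<and> real p \<le> y}" and ?T = "{p. prime p \<and> y < real p \<and> real p \<le> x}"
  have fin: "finite ?S" "finite ?T" "finite ?P"
    by (rule finite_primes_le_real finite_subset[OF _ finite_primes_le_real[of x]] | blast)+
  have "?S \<subseteq> {1..nat \<lfloor>y\<rfloor>}"
    by (auto simp: le_nat_floor Suc_le_eq prime_gt_0_nat)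
  then have "card ?S \<le> nat \<lfloor>y\<rfloor>"
    using card_mono[of "{1..nat \<lfloor>y\<rfloor>}" ?S] by simp
  then have S: "real (card ?S) \<le> y" using y by linarith
  have "real (card ?T) * ln y = (\<Sum>p\<in>?T. ln y)" by simp
  also have "\<dots> \<le> (\<Sum>p\<in>?T. mangoldt p)"
    using y by (intro sum_mono) auto
  also have "\<dots> \<le> psi (nat \<lfloor>x\<rfloor>)"
    unfolding psi_def by (intro sum_mono2 mangoldt_nonneg) (auto simp: le_nat_floor)
  finally have T: "real (card ?T) \<le> psi (nat \<lfloor>x\<rfloor>) / ln y"
    using y by (simp add: field_simps)
  have "card ?P \<le> card (?S \<union> ?T)"
    using fin by (intro card_mono) auto
  also have "\<dots> \<le> card ?S + card ?T" by (rule card_Un_le)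
  finally show ?thesis using S T by (simp add: prime_pi_def)
qed

lemma prime_pi_asymptotics_of_psi:
  assumes psi: "(\<lambda>n. psi n / real n) \<longlonglongrightarrow> 1"
  shows "((\<lambda>x. real (prime_pi x) * ln x / x) \<longlongrightarrow> 1) at_top"
proof -
  let ?N = "\<lambda>x::real. nat \<lfloor>x\<rfloor>"
  have N: "filterlim ?N sequentially at_top"
    by (intro filterlim_compose[OF filterlim_nat_sequentially] filterlim_floor_sequentially)
  have "((\<lambda>x. real (?N x) / x) \<longlongrightarrow> 1) at_top"
  proof -
    have "((\<lambda>x. of_int \<lfloor>x\<rfloor> / x) \<longlongrightarrow> (1::real)) at_top" by real_asymp
    moreover have "\<forall>\<^sub>F x in at_top. of_int \<lfloor>x\<rfloor> / x = real (?N x) / x"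
      using eventually_ge_at_top[of 0] by eventually_elim simp
    ultimately show ?thesis by (rule Lim_transform_eventually)
  qed
  then have "((\<lambda>x. (psi (?N x) / real (?N x)) * (real (?N x) / x)) \<longlongrightarrow> 1 * 1) at_top"
    using filterlim_compose[OF psi N] by (intro tendsto_mult)
  moreover have "\<forall>\<^sub>F x in at_top. (psi (?N x) / real (?N x)) * (real (?N x) / x) = psi (?N x) / x"
    using eventually_ge_at_top[of 1]
  proof eventually_elim
    case (elim x)
    then have "?N x > 0" by (simp add: floor_le_one)
    then show ?case by simp
  qed
  ultimately have lim: "((\<lambda>x. psi (?N x) / x) \<longlongrightarrow> 1) at_top"
    by (auto intro: Lim_transform_eventually)
  show ?thesis
  proof (rule tendsto_sandwich)
    show "\<forall>\<^sub>F x in at_top. psi (?N x) / x \<le> real (prime_pi x) * ln x / x"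
      using eventually_ge_at_top[of 1]
    proof eventually_elim
      case (elim x)
      have N: "?N x > 0" "real (?N x) \<le> x" using elim by (auto simp: floor_le_one)
      have "prime_pi (real (?N x)) \<le> prime_pi x"
        unfolding prime_pi_def
        by (intro card_mono finite_primes_le_real Collect_mono) (metis N(2) order_trans)
      then have "real (prime_pi (real (?N x))) * ln (real (?N x)) \<le> real (prime_pi x) * ln x"
        using N by (intro mult_mono) auto
      then show ?case
        using psi_le_prime_pi_mult_ln[OF N(1)] elim by (intro divide_right_mono) auto
    qed
    \<comment> \<open>The cut y = x / (ln x)^2 is small enough that y ln x / x = 1 / ln x tends to
      0, yet large enough that ln y is asymptotic to ln x.\<close>
    have "\<forall>\<^sub>F x::real in at_top. x / ln x ^ 2 > 1" by real_asymp
    then show "\<forall>\<^sub>F x in at_top. real (prime_pi x) * ln x / x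
          \<le> 1 / ln x + psi (?N x) / x * (ln x / ln (x / ln x ^ 2))"
      using eventually_gt_at_top[of 1]
    proof eventually_elim
      case (elim x)
      have "(u / v ^ 2 + p / w) * (v / u) = 1 / v + p / u * (v / w)" if "u > 0" "v > 0" for u v p w :: real
        using that by (simp add: distrib_right power2_eq_square add_divide_distrib)
      from this[of x "ln x" "psi (?N x)" "ln (x / ln x ^ 2)"]
      have eq: "(x / ln x ^ 2 + psi (?N x) / ln (x / ln x ^ 2)) * (ln x / x)
          = 1 / ln x + psi (?N x) / x * (ln x / ln (x / ln x ^ 2))"
        using elim by simp
      have "real (prime_pi x) * (ln x / x) \<le> (x / ln x ^ 2 + psi (?N x) / ln (x / ln x ^ 2)) * (ln x / x)"
        using elim by (intro mult_right_mono prime_pi_le) auto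
      also note eq
      finally show ?case by simp
    qed
    have "((\<lambda>x::real. ln x / ln (x / ln x ^ 2)) \<longlongrightarrow> 1) at_top" by real_asymp
    moreover have "((\<lambda>x::real. 1 / ln x) \<longlongrightarrow> 0) at_top" by real_asymp
    ultimately have "((\<lambda>x. 1 / ln x + psi (?N x) / x * (ln x / ln (x / ln x ^ 2))) \<longlongrightarrow> 0 + 1 * 1) at_top"
      using lim by (intro tendsto_add tendsto_mult)
    then show "((\<lambda>x. 1 / ln x + psi (?N x) / x * (ln x / ln (x / ln x ^ 2))) \<longlongrightarrow> 1) at_top"
      by simp
  qed (rule lim)
qed

theorem theorem2p2p1:
  "(\<lambda>x :: real. real (prime_pi x)) \<sim>[at_top] (\<lambda>x. x / ln x) \<and>
   ((\<lambda>x :: real. real (prime_pi x) * ln x / x) \<longlongrightarrow> 1) at_top"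
proof
  show *: "((\<lambda>x :: real. real (prime_pi x) * ln x / x) \<longlongrightarrow> 1) at_top"
    using psi_asymptotics by (rule prime_pi_asymptotics_of_psi)
  then show "(\<lambda>x :: real. real (prime_pi x)) \<sim>[at_top] (\<lambda>x. x / ln x)"
    by (intro asymp_equivI') simp
qed

end
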